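(* Let $\delta>0$ and $T>0$, and let $f,g:\mathbb{R}\to\mathbb{R}$ be sufficiently smooth functions such that, for each $\varepsilon\ge 0$ considered, the initial value problem $$\eta_t+u_x+(\eta u)_x=0,\qquad u_t+\eta_x+uu_x-\delta u_{xxt}-\varepsilon u_{xx}=0,\qquad x\in\mathbb{R},\ t\in[0,T],$$ with initial data $(\eta(x,0),u(x,0))=(f(x),g(x))$ has a unique solution $(\eta^\varepsilon,u^\varepsilon)$, with $(\eta^\varepsilon,u^\varepsilon)\in C^1([0,T],H^1\times H^2)$ if $\varepsilon>0$ and $(\eta^0,u^0)\in C^1([0,T],H^2\times H^2)$ if $\varepsilon=0$. For $\varepsilon>0$ set $(h,w)=(\eta^\varepsilon-\eta^0,\,u^\varepsilon-u^0)$. Then $$\sqrt{\|h(\cdot,t)\|^2+\|w(\cdot,t)\|^2+\|w_x(\cdot,t)\|^2}=O(\varepsilon t)\quad\text{for all } t\in[0,T];$$ that is, there is a constant $C>0$, independent of $\varepsilon$ and $t$ and depending only on $\delta$, $T$ and on bounds of the two solutions (a number $K$ such that $\|\eta^\varepsilon(\cdot,t)\|_1+\|u^\varepsilon(\cdot,t)\|_2\le K$ and $\|\eta^0(\cdot,t)\|_2+\|u^0(\cdot,t)\|_2\le K$ for all $t\in[0,T]$), such that the left-hand side is at most $C\varepsilon t$ for all $t\in[0,T]$.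
   Context: $H^s=H^s(\mathbb{R})$ is the usual $L^2$-based Sobolev space with norm $\|\cdot\|_s$, and $\|\cdot\|$ is the norm of $L^2(\mathbb{R})$. *)

theory Defs
  imports "HOL-Analysis.Analysis"
begin

text \<open>Elements of \<open>L\<^sup>2\<close> and of the Sobolev spaces are represented by functions, with
  equality meaning equality almost everywhere. Each predicate below is invariant under changing
  a Borel representative on a null set.\<close>

definition test_function :: "(real \<Rightarrow> real) \<Rightarrow> bool" where
  "test_function \<phi> \<longleftrightarrow>
     (\<forall>n. ((deriv ^^ n) \<phi>) differentiable_on UNIV) \<and> (\<exists>R. \<forall>x. \<bar>x\<bar> > R \<longrightarrow> \<phi> x = 0)"

definition locally_integrable :: "(real \<Rightarrow> real) \<Rightarrow> bool" where
  "locally_integrable f \<longleftrightarrow> (\<forall>a b. set_integrable lborel {a..b} f)"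

definition has_weak_deriv :: "nat \<Rightarrow> (real \<Rightarrow> real) \<Rightarrow> (real \<Rightarrow> real) \<Rightarrow> bool" where
  "has_weak_deriv j f g \<longleftrightarrow> locally_integrable f \<and> locally_integrable g \<and>
     (\<forall>\<phi>. test_function \<phi> \<longrightarrow>
        (LINT x|lborel. f x * (deriv ^^ j) \<phi> x) = (-1) ^ j * (LINT x|lborel. g x * \<phi> x))"

text \<open>The weak derivative is unique only up to a null set; the choice operator picks one
  representative. The value is meaningless if \<open>f\<close> has no weak derivative of order \<open>j\<close>.\<close>

definition weak_deriv :: "nat \<Rightarrow> (real \<Rightarrow> real) \<Rightarrow> real \<Rightarrow> real" where
  "weak_deriv j f = (SOME g. has_weak_deriv j f g)"

definition square_integrable :: "(real \<Rightarrow> real) \<Rightarrow> bool" where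
  "square_integrable f \<longleftrightarrow> f \<in> borel_measurable lborel \<and> integrable lborel (\<lambda>x. (f x)\<^sup>2)"

definition L2_norm :: "(real \<Rightarrow> real) \<Rightarrow> real" where
  "L2_norm f = sqrt (LINT x|lborel. (f x)\<^sup>2)"

definition sobolev :: "nat \<Rightarrow> (real \<Rightarrow> real) \<Rightarrow> bool" where
  "sobolev k f \<longleftrightarrow> square_integrable f \<and> (\<forall>j\<le>k. \<exists>g. has_weak_deriv j f g \<and> square_integrable g)"

definition sobolev_norm :: "nat \<Rightarrow> (real \<Rightarrow> real) \<Rightarrow> real" where
  "sobolev_norm k f = sqrt (\<Sum>j\<le>k. (L2_norm (weak_deriv j f))\<^sup>2)"

text \<open>Functions of space and time take the time variable first, so that \<open>v t\<close> is the spatial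
  profile \<open>v(\<cdot>,t)\<close>. The following says that \<open>v \<in> C\<^sup>1([0,T], H\<^sup>k)\<close> with derivative \<open>v'\<close>:
  difference quotients converge in \<open>H\<^sup>k\<close> (one-sidedly at the end points) and \<open>v'\<close> is
  continuous into \<open>H\<^sup>k\<close>. Nothing is said about times outside \<open>[0,T]\<close>.\<close>

definition C1_sobolev ::
    "nat \<Rightarrow> real \<Rightarrow> (real \<Rightarrow> real \<Rightarrow> real) \<Rightarrow> (real \<Rightarrow> real \<Rightarrow> real) \<Rightarrow> bool" where
  "C1_sobolev k T v v' \<longleftrightarrow>
     (\<forall>t\<in>{0..T}. sobolev k (v t) \<and> sobolev k (v' t) \<and>
        ((\<lambda>s. sobolev_norm k (\<lambda>x. (v s x - v t x) / (s - t) - v' t x)) \<longlongrightarrow> 0)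
          (at t within {0..T}) \<and>
        ((\<lambda>s. sobolev_norm k (\<lambda>x. v' s x - v' t x)) \<longlongrightarrow> 0) (at t within {0..T}))"

text \<open>\<open>(\<eta>, u) \<in> C\<^sup>1([0,T], H\<^sup>k \<times> H\<^sup>2)\<close> solves the initial value problem; the equations are
  identities in \<open>L\<^sup>2\<close> for every \<open>t\<close>. The term \<open>u\<^sub>x\<^sub>x\<^sub>t\<close> is read as \<open>(u\<^sub>t)\<^sub>x\<^sub>x\<close>, which is the same
  since \<open>v \<mapsto> v\<^sub>x\<^sub>x\<close> is bounded from \<open>H\<^sup>2\<close> to \<open>L\<^sup>2\<close>.\<close>

definition ivp_solution ::
    "real \<Rightarrow> real \<Rightarrow> real \<Rightarrow> nat \<Rightarrow> (real \<Rightarrow> real) \<Rightarrow> (real \<Rightarrow> real) \<Rightarrow>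
     (real \<Rightarrow> real \<Rightarrow> real) \<Rightarrow> (real \<Rightarrow> real \<Rightarrow> real) \<Rightarrow> bool" where
  "ivp_solution \<delta> \<epsilon> T k f g \<eta> u \<longleftrightarrow>
     (\<exists>\<eta>\<^sub>t u\<^sub>t. C1_sobolev k T \<eta> \<eta>\<^sub>t \<and> C1_sobolev 2 T u u\<^sub>t \<and>
        (\<forall>t\<in>{0..T}. AE x in lborel.
           \<eta>\<^sub>t t x + weak_deriv 1 (u t) x + weak_deriv 1 (\<lambda>y. \<eta> t y * u t y) x = 0) \<and>
        (\<forall>t\<in>{0..T}. AE x in lborel.
           u\<^sub>t t x + weak_deriv 1 (\<eta> t) x + u t x * weak_deriv 1 (u t) x
             - \<delta> * weak_deriv 2 (u\<^sub>t t) x - \<epsilon> * weak_deriv 2 (u t) x = 0)) \<and>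
     (AE x in lborel. \<eta> 0 x = f x) \<and> (AE x in lborel. u 0 x = g x)"

definition unique_ivp_solution ::
    "real \<Rightarrow> real \<Rightarrow> real \<Rightarrow> nat \<Rightarrow> (real \<Rightarrow> real) \<Rightarrow> (real \<Rightarrow> real) \<Rightarrow>
     (real \<Rightarrow> real \<Rightarrow> real) \<Rightarrow> (real \<Rightarrow> real \<Rightarrow> real) \<Rightarrow> bool" where
  "unique_ivp_solution \<delta> \<epsilon> T k f g \<eta> u \<longleftrightarrow> ivp_solution \<delta> \<epsilon> T k f g \<eta> u \<and>
     (\<forall>\<eta>' u'. ivp_solution \<delta> \<epsilon> T k f g \<eta>' u' \<longrightarrow>
        (\<forall>t\<in>{0..T}. (AE x in lborel. \<eta>' t x = \<eta> t x) \<and> (AE x in lborel. u' t x = u t x)))"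

end

theory Submission
  imports Defs "HOL-Computational_Algebra.Polynomial"
begin

text \<open>
  With \<open>h = \<eta>\<epsilon> - \<eta>0\<close>, \<open>w = u\<epsilon> - u0\<close>, the nonlinear terms split as
  \<open>\<eta>\<epsilon> u\<epsilon> - \<eta>0 u0 = \<eta>0 w + h u\<epsilon>\<close> and \<open>u\<epsilon> u\<epsilon>\<^sub>x - u0 u0\<^sub>x = u\<epsilon> w\<^sub>x + w u0\<^sub>x\<close>.
  Testing the difference of the two systems with \<open>(h, w)\<close>, the term with \<open>h\<^sub>x\<close> in
  \<open>(h u\<epsilon>)\<^sub>x\<close> is removed by an integration by parts, and the energy
  \<open>E = \<parallel>h\<parallel>\<^sup>2 + \<parallel>w\<parallel>\<^sup>2 + \<delta> \<parallel>w\<^sub>x\<parallel>\<^sup>2\<close> satisfies \<open>E' \<le> 2 A E + 2 \<epsilon> K sqrt E\<close> and \<open>E 0 = 0\<close>.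
  Gronwall's inequality for \<open>sqrt E\<close> gives the bound \<open>\<epsilon> K t exp (A t)\<close>.
  Everything is reduced to absolutely continuous representatives, which exist by the
  fundamental lemma of the calculus of variations and du Bois-Reymond's lemma.
\<close>

subsection \<open>Smooth functions with compact support\<close>

text \<open>The asymmetric splitting is dictated by regularity. \<open>\<eta>0\<close> lies in H^2,
  so its derivative has a sup bound, whereas \<open>\<eta>\<epsilon>\<close> lies only in H^1; hence
  \<open>w\<close> is multiplied by \<open>\<eta>0\<close>, and \<open>h\<close> by
  \<open>u\<epsilon>\<close>. The derivative h_x is not controlled by the energy and may occur only
  in two places: in h (h u\<epsilon>)_x, where integration by parts leaves half of h^2
  u\<epsilon>_x, and in w h_x, which cancels against h w_x. First derivatives of \<open>w\<close>
  are harmless because -\<delta> u_xxt puts \<delta> times the squared norm of w_x into the energy.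
  The viscous term is kept whole as a forcing \<epsilon> u\<epsilon>_xx, bounded in L^2 by
  \<epsilon> K; as it is paired with \<open>w\<close> only once, it yields \<epsilon> sqrt E and
  therefore growth like \<epsilon> t from zero data. The definitions speak only of a.e. classes and
  test functions, with weak derivatives picked by choice; the products and boundary terms of these
  integrations by parts therefore need representatives that satisfy an integral formula.\<close>

primrec times_differentiable :: "nat \<Rightarrow> (real \<Rightarrow> real) \<Rightarrow> bool" where
  "times_differentiable 0 f \<longleftrightarrow> True"
| "times_differentiable (Suc n) f \<longleftrightarrow>
     (\<exists>f'. (\<forall>x. (f has_real_derivative f' x) (at x)) \<and> times_differentiable n f')"

lemma times_differentiable_Suc_iff_deriv:
  "times_differentiable (Suc n) f \<longleftrightarrow>
     (\<forall>x. (f has_real_derivative deriv f x) (at x)) \<and> times_differentiable n (deriv f)"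
proof
  assume "times_differentiable (Suc n) f"
  then obtain f' where f': "\<And>x. (f has_real_derivative f' x) (at x)" "times_differentiable n f'"
    by auto
  then have "deriv f = f'" by (auto simp: DERIV_imp_deriv)
  with f' show "(\<forall>x. (f has_real_derivative deriv f x) (at x)) \<and> times_differentiable n (deriv f)"
    by simp
qed auto

lemma times_differentiable_SucD: "times_differentiable (Suc n) f \<Longrightarrow> times_differentiable n f"
  by (induction n arbitrary: f) (simp, metis times_differentiable.simps(2))

lemma times_differentiable_add:
  "times_differentiable n f \<Longrightarrow> times_differentiable n g \<Longrightarrow> times_differentiable n (\<lambda>x. f x + g x)"
proof (induction n arbitrary: f g)
  case (Suc n)
  then obtain f' g' where "\<And>x. (f has_real_derivative f' x) (at x)" "times_differentiable n f'"
    "\<And>x. (g has_real_derivative g' x) (at x)" "times_differentiable n g'" by auto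
  with Suc.IH show ?case
    by (auto intro!: exI[of _ "\<lambda>x. f' x + g' x"] derivative_intros)
qed simp

lemma times_differentiable_mult:
  "times_differentiable n f \<Longrightarrow> times_differentiable n g \<Longrightarrow> times_differentiable n (\<lambda>x. f x * g x)"
proof (induction n arbitrary: f g)
  case (Suc n)
  then obtain f' g' where d: "\<And>x. (f has_real_derivative f' x) (at x)" "times_differentiable n f'"
    "\<And>x. (g has_real_derivative g' x) (at x)" "times_differentiable n g'" by auto
  have "times_differentiable n f" "times_differentiable n g"
    using Suc.prems times_differentiable_SucD by auto
  then have "times_differentiable n (\<lambda>x. f' x * g x + g' x * f x)"
    by (intro times_differentiable_add Suc.IH d)
  moreover have "((\<lambda>x. f x * g x) has_real_derivative f' x * g x + g' x * f x) (at x)" for x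
    by (intro DERIV_mult d)
  ultimately show ?case
    unfolding times_differentiable.simps(2) by (intro exI[of _ "\<lambda>x. f' x * g x + g' x * f x"]) blast
qed simp

lemma times_differentiable_const: "times_differentiable n (\<lambda>x. c)"
  by (induction n arbitrary: c) (auto intro!: exI[of _ "\<lambda>x. 0"])

lemma times_differentiable_affine:
  "times_differentiable n f \<Longrightarrow> times_differentiable n (\<lambda>x. f (a * x + b))"
proof (induction n arbitrary: f)
  case (Suc n)
  then obtain f' where d: "\<And>x. (f has_real_derivative f' x) (at x)" "times_differentiable n f'"
    by auto
  have "((\<lambda>x. f (a * x + b)) has_real_derivative f' (a * x + b) * a) (at x)" for x
    by (rule DERIV_chain2[OF d(1)]) (auto intro!: derivative_eq_intros)
  moreover have "times_differentiable n (\<lambda>x. f' (a * x + b) * a)"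
    by (intro times_differentiable_mult times_differentiable_const Suc.IH d)
  ultimately show ?case
    unfolding times_differentiable.simps(2) by (intro exI[of _ "\<lambda>x. f' (a * x + b) * a"]) blast
qed simp

text \<open>Passes from iterates of \<open>deriv\<close> to the recursive form, in which closure
  under sums, products and affine substitutions is an induction with explicit derivatives as
  witnesses. Both directions strip the innermost derivative, whence
  \<open>funpow_swap1\<close>.\<close>

lemma higher_deriv_differentiable_iff:
  "(\<forall>n. ((deriv ^^ n) f) differentiable_on UNIV) \<longleftrightarrow> (\<forall>n. times_differentiable n f)"
proof
  assume *: "\<forall>n. ((deriv ^^ n) f) differentiable_on UNIV"
  show "\<forall>n. times_differentiable n f"
  proof
    fix n
    from * show "times_differentiable n f"
    proof (induction n arbitrary: f)
      case (Suc n)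
      have "(deriv ^^ m) (deriv f) differentiable_on UNIV" for m
        using Suc.prems[rule_format, of "Suc m"] by (simp add: funpow_swap1)
      moreover have "(f has_real_derivative deriv f x) (at x)" for x
        using Suc.prems[rule_format, of 0]
        by (simp add: differentiable_on_def real_differentiable_def DERIV_deriv_iff_real_differentiable)
      ultimately show ?case
        using Suc.IH unfolding times_differentiable_Suc_iff_deriv by blast
    qed simp
  qed
next
  assume *: "\<forall>n. times_differentiable n f"
  show "\<forall>n. ((deriv ^^ n) f) differentiable_on UNIV"
  proof
    fix n
    from * show "(deriv ^^ n) f differentiable_on UNIV"
    proof (induction n arbitrary: f)
      case 0
      then have "times_differentiable 1 f" by blast
      then show ?case
        by (auto simp: differentiable_on_def real_differentiable_def)
    next
      case (Suc n)
      then have "\<forall>n. times_differentiable n (deriv f)"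
        using times_differentiable_Suc_iff_deriv by blast
      then show ?case using Suc.IH by (simp add: funpow_swap1)
    qed
  qed
qed

lemma test_function_iff:
  "test_function \<phi> \<longleftrightarrow>
     (\<forall>n. times_differentiable n \<phi>) \<and> (\<exists>R. \<forall>x. \<bar>x\<bar> > R \<longrightarrow> \<phi> x = 0)"
  by (simp add: test_function_def higher_deriv_differentiable_iff)

lemma test_function_mult:
  "test_function \<phi> \<Longrightarrow> (\<And>n. times_differentiable n f) \<Longrightarrow> test_function (\<lambda>x. \<phi> x * f x)"
  by (auto simp: test_function_iff intro!: times_differentiable_mult)

lemma test_function_add:
  assumes "test_function \<phi>" "test_function \<psi>"
  shows "test_function (\<lambda>x. \<phi> x + \<psi> x)"
proof -
  obtain R S where "\<And>x. \<bar>x\<bar> > R \<Longrightarrow> \<phi> x = 0" "\<And>x. \<bar>x\<bar> > S \<Longrightarrow> \<psi> x = 0"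
    using assms by (auto simp: test_function_iff)
  then have "\<forall>x. \<bar>x\<bar> > max R S \<longrightarrow> \<phi> x + \<psi> x = 0" by auto
  with assms show ?thesis
    unfolding test_function_iff by (blast intro: times_differentiable_add)
qed

lemma test_function_has_deriv:
  "test_function \<phi> \<Longrightarrow> (\<phi> has_real_derivative deriv \<phi> x) (at x)"
  by (metis test_function_iff times_differentiable_Suc_iff_deriv)

lemma test_function_deriv:
  assumes "test_function \<phi>"
  shows "test_function (deriv \<phi>)"
proof -
  obtain R where R: "\<And>x. \<bar>x\<bar> > R \<Longrightarrow> \<phi> x = 0"
    using assms by (auto simp: test_function_iff)
  have "deriv \<phi> x = 0" if "\<bar>x\<bar> > R" for x
  proof -
    have "eventually (\<lambda>y. y \<in> {y. \<bar>y\<bar> > R}) (nhds x)"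
      using that by (intro eventually_nhds_in_open) (auto intro!: open_Collect_less continuous_intros)
    then have "eventually (\<lambda>y. \<phi> y = 0) (nhds x)"
      by (rule eventually_mono) (use R in auto)
    then have "deriv \<phi> x = deriv (\<lambda>y. 0) x"
      by (rule deriv_cong_ev) simp
    then show ?thesis by simp
  qed
  moreover have "\<forall>n. times_differentiable n (deriv \<phi>)"
    using assms by (metis test_function_iff times_differentiable_Suc_iff_deriv)
  ultimately show ?thesis unfolding test_function_iff by blast
qed

lemma test_function_continuous: "test_function \<phi> \<Longrightarrow> continuous_on A \<phi>"
  by (meson DERIV_continuous_on has_field_derivative_at_within test_function_has_deriv)

lemma test_function_measurable: "test_function \<phi> \<Longrightarrow> \<phi> \<in> borel_measurable borel"
  by (simp add: borel_measurable_continuous_onI test_function_continuous)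

lemma test_function_bounded:
  assumes "test_function \<phi>"
  obtains B where "\<And>x. \<bar>\<phi> x\<bar> \<le> B"
proof -
  obtain R where R: "\<And>x. \<bar>x\<bar> > R \<Longrightarrow> \<phi> x = 0"
    using assms by (auto simp: test_function_iff)
  have "bounded (\<phi> ` {-R..R})"
    using assms by (intro compact_imp_bounded compact_continuous_image test_function_continuous) auto
  then obtain B where B: "\<And>x. x \<in> {-R..R} \<Longrightarrow> \<bar>\<phi> x\<bar> \<le> B"
    by (metis bounded_real image_eqI)
  have "\<bar>\<phi> x\<bar> \<le> max B 0" for x
    using R[of x] B[of x] by fastforce
  then show ?thesis using that by blast
qed

subsection \<open>A flat function\<close>

text \<open>The classical case is \<open>flat 1\<close>, that is exp (-1/x) extended by 0. A
  polynomial factor in 1/x is carried along because the class is then closed under differentiation: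
  \<open>p\<close> becomes X^2 (p - p').\<close>

definition flat :: "real poly \<Rightarrow> real \<Rightarrow> real" where
  "flat p x = (if x \<le> 0 then 0 else poly p (1 / x) * exp (- (1 / x)))"

lemma poly_div_exp_tendsto_0: "((\<lambda>t. poly p t / exp t) \<longlongrightarrow> (0::real)) at_top"
proof -
  have "((\<lambda>t. \<Sum>i\<le>degree p. coeff p i * (t ^ i / exp t)) \<longlongrightarrow> (\<Sum>i\<le>degree p. coeff p i * 0)) at_top"
    by (intro tendsto_intros tendsto_power_div_exp_0)
  then show ?thesis by (simp add: poly_altdef sum_divide_distrib)
qed

lemma flat_tendsto_0: "(flat p \<longlongrightarrow> 0) (at 0)"
proof -
  have "((\<lambda>x::real. poly p (inverse x) / exp (inverse x)) \<longlongrightarrow> 0) (at_right 0)"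
    by (rule filterlim_compose[OF poly_div_exp_tendsto_0 filterlim_inverse_at_top_right])
  then have "(flat p \<longlongrightarrow> 0) (at_right 0)"
    by (rule tendsto_cong[THEN iffD1, rotated])
      (auto simp: eventually_at_filter flat_def exp_minus field_simps)
  moreover have "(flat p \<longlongrightarrow> 0) (at_left 0)"
    by (rule tendsto_eventually) (auto simp: eventually_at_filter flat_def)
  ultimately show ?thesis by (simp add: filterlim_at_split)
qed

lemma flat_has_deriv:
  "(flat p has_real_derivative flat (monom 1 2 * (p - pderiv p)) x) (at x)"
proof -
  consider "x < 0" | "x = 0" | "x > 0" by linarith
  then show ?thesis
  proof cases
    case 1
    have "((\<lambda>x. 0) has_real_derivative 0) (at x)" by simp
    then have "(flat p has_real_derivative 0) (at x)"
      by (rule DERIV_cong_ev[THEN iffD1, rotated -1])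
        (use 1 eventually_nhds_in_open[of "{..<0}" x] in \<open>auto simp: flat_def elim: eventually_mono\<close>)
    with 1 show ?thesis by (simp add: flat_def)
  next
    case 2
    \<comment> \<open>Dividing by \<open>y\<close> multiplies \<open>p\<close> by its variable, so
      the difference quotient at 0 is itself a flat function and tends to 0.\<close>
    have "((\<lambda>y. (flat p y - flat p 0) / (y - 0)) \<longlongrightarrow> 0) (at 0)"
      using flat_tendsto_0[of "monom 1 1 * p"]
      by (rule tendsto_cong[THEN iffD1, rotated])
        (auto simp: eventually_at_filter flat_def poly_monom field_simps)
    with 2 show ?thesis by (simp add: flat_def has_field_derivative_iff)
  next
    case 3
    have "((\<lambda>x. poly p (1 / x) * exp (- (1 / x))) has_real_derivative
        flat (monom 1 2 * (p - pderiv p)) x) (at x)"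
    proof -
      have i: "((\<lambda>x. 1 / x) has_real_derivative - (1 / x\<^sup>2)) (at x)"
        using 3 by (auto intro!: derivative_eq_intros simp: power2_eq_square)
      have "((\<lambda>x. exp (- (1 / x))) has_real_derivative exp (- (1 / x)) * (- (- (1 / x\<^sup>2)))) (at x)"
        by (intro DERIV_chain2[OF DERIV_exp] DERIV_minus i)
      then have "((\<lambda>x. poly p (1 / x) * exp (- (1 / x))) has_real_derivative
          poly (pderiv p) (1 / x) * - (1 / x\<^sup>2) * exp (- (1 / x)) +
          exp (- (1 / x)) * (- (- (1 / x\<^sup>2))) * poly p (1 / x)) (at x)"
        by (intro DERIV_mult DERIV_chain2[OF poly_DERIV i])
      moreover have "poly (pderiv p) (1 / x) * - (1 / x\<^sup>2) * exp (- (1 / x)) +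
          exp (- (1 / x)) * (- (- (1 / x\<^sup>2))) * poly p (1 / x) = flat (monom 1 2 * (p - pderiv p)) x"
        using 3 by (simp add: flat_def poly_monom algebra_simps power_divide)
      ultimately show ?thesis by simp
    qed
    then show ?thesis
      by (rule DERIV_cong_ev[THEN iffD1, rotated -1])
        (use 3 eventually_nhds_in_open[of "{0<..}" x] in \<open>auto simp: flat_def elim: eventually_mono\<close>)
  qed
qed

lemma flat_times_differentiable: "times_differentiable n (flat p)"
proof (induction n arbitrary: p)
  case (Suc n)
  then show ?case
    unfolding times_differentiable.simps(2) using flat_has_deriv by blast
qed simp

text \<open>Dilating \<open>exp (- 1 / x)\<close> by \<open>n\<close> amounts to taking its \<open>n\<close>-th root, so that these functions
  increase to the indicator function of \<open>{a<..<b}\<close> while their supports stay fixed.\<close>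

definition bump :: "nat \<Rightarrow> real \<Rightarrow> real \<Rightarrow> real \<Rightarrow> real" where
  "bump n a b x = flat 1 (real n * x + - (real n * a)) * flat 1 (- real n * x + real n * b)"

lemma test_function_bump: "test_function (bump (Suc n) a b)"
proof -
  have "bump (Suc n) a b x = 0" if "\<bar>x\<bar> > max \<bar>a\<bar> \<bar>b\<bar>" for x
  proof -
    have "x < a \<or> b < x" using that by linarith
    then have "real (Suc n) * x + - (real (Suc n) * a) \<le> 0 \<or> - real (Suc n) * x + real (Suc n) * b \<le> 0"
      using mult_left_mono[of x a "real (Suc n)"] mult_left_mono[of b x "real (Suc n)"]
      by (smt (verit) mult_minus_left of_nat_0_le_iff)
    then show ?thesis by (auto simp: bump_def flat_def)
  qed
  moreover have "times_differentiable k (bump (Suc n) a b)" for k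
    unfolding bump_def[abs_def]
    by (intro times_differentiable_mult times_differentiable_affine flat_times_differentiable)
  ultimately show ?thesis unfolding test_function_iff by blast
qed

text \<open>The dilation is written \<open>Suc n\<close> since for factor 0 the bump is identically
  0, while the right-hand side, with 1 / 0 = 0, would be the indicator function.\<close>

lemma bump_eq:
  "bump (Suc n) a b x = (if a < x \<and> x < b then exp (- (1 / (real (Suc n) * (x - a)))) *
     exp (- (1 / (real (Suc n) * (b - x)))) else 0)"
proof -
  have "real (Suc n) * x + - (real (Suc n) * a) = real (Suc n) * (x - a)"
    "- real (Suc n) * x + real (Suc n) * b = real (Suc n) * (b - x)"
    by (simp_all add: algebra_simps)
  then show ?thesis
    unfolding bump_def flat_def by (auto simp: mult_le_0_iff simp del: of_nat_Suc)
qed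

lemma bump_bounds: "0 \<le> bump (Suc n) a b x" "bump (Suc n) a b x \<le> indicator {a<..<b} x"
proof -
  have "0 \<le> 1 / (real (Suc n) * (x - a))" "0 \<le> 1 / (real (Suc n) * (b - x))" if "a < x" "x < b"
    using that by (simp_all del: of_nat_Suc)
  then show "0 \<le> bump (Suc n) a b x" "bump (Suc n) a b x \<le> indicator {a<..<b} x"
    unfolding bump_eq by (auto intro!: mult_le_one simp del: of_nat_Suc)
qed

lemma bump_tendsto: "(\<lambda>n. bump (Suc n) a b x) \<longlonglongrightarrow> indicator {a<..<b} x"
proof (cases "a < x \<and> x < b")
  case True
  have *: "(\<lambda>n. 1 / (real (Suc n) * c)) \<longlonglongrightarrow> 0" for c
    using tendsto_mult_right[OF LIMSEQ_inverse_real_of_nat, of "1/c"]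
    by (simp add: field_simps del: of_nat_Suc)
  have "(\<lambda>n. exp (- (1 / (real (Suc n) * (x - a)))) * exp (- (1 / (real (Suc n) * (b - x)))))
     \<longlonglongrightarrow> exp (- 0) * exp (- 0)"
    by (intro tendsto_intros *)
  with True show ?thesis by (simp add: bump_eq del: of_nat_Suc)
qed (auto simp: bump_eq)

subsection \<open>The fundamental lemma of the calculus of variations\<close>

text \<open>Only the truncations to bounded intervals are known to be measurable; \<open>f\<close>
  is their pointwise limit, the sequence being eventually constant at each point.\<close>

lemma locally_integrable_measurable:
  assumes "locally_integrable f"
  shows "f \<in> borel_measurable lborel"
proof (rule borel_measurable_LIMSEQ_metric)
  show "(\<lambda>x. indicator {-real n..real n} x *\<^sub>R f x) \<in> borel_measurable lborel" for n
    using assms unfolding locally_integrable_def set_integrable_def by blast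
  fix x :: real
  have "eventually (\<lambda>n. indicator {-real n..real n} x *\<^sub>R f x = f x) sequentially"
    using eventually_ge_at_top[of "nat \<lceil>\<bar>x\<bar>\<rceil>"]
    by eventually_elim (simp add: indicator_def, linarith)
  then show "(\<lambda>n. indicator {-real n..real n} x *\<^sub>R f x) \<longlonglongrightarrow> f x"
    by (rule tendsto_eventually)
qed

lemma locally_integrable_mult_bounded:
  assumes f: "locally_integrable f" and g: "g \<in> borel_measurable borel"
    and B: "\<And>a b. \<exists>B. \<forall>x\<in>{a..b}. \<bar>g x\<bar> \<le> B"
  shows "locally_integrable (\<lambda>x. f x * g x)"
  unfolding locally_integrable_def
proof (intro allI)
  fix a b :: real
  obtain C where C: "\<And>x. x \<in> {a..b} \<Longrightarrow> \<bar>g x\<bar> \<le> C" using B by blast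
  have [measurable]: "f \<in> borel_measurable lborel" "g \<in> borel_measurable lborel"
    using locally_integrable_measurable[OF f] g by auto
  have i: "integrable lborel (\<lambda>x. C * (indicator {a..b} x *\<^sub>R f x))"
    using f unfolding locally_integrable_def set_integrable_def by (intro integrable_mult_right) blast
  show "set_integrable lborel {a..b} (\<lambda>x. f x * g x)"
    unfolding set_integrable_def
  proof (rule Bochner_Integration.integrable_bound[OF i])
    show "AE x in lborel. norm (indicator {a..b} x *\<^sub>R (f x * g x)) \<le> norm (C * (indicator {a..b} x *\<^sub>R f x))"
    proof (rule AE_I2)
      fix x :: real
      show "norm (indicator {a..b} x *\<^sub>R (f x * g x)) \<le> norm (C * (indicator {a..b} x *\<^sub>R f x))"
      proof (cases "x \<in> {a..b}")
        case True
        then have "\<bar>g x\<bar> \<le> \<bar>C\<bar>" using C[of x] by linarith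
        with True show ?thesis by (simp add: abs_mult mult.commute[of _ "\<bar>f x\<bar>"] mult_left_mono)
      qed simp
    qed
  qed measurable
qed

lemma locally_integrable_add:
  "locally_integrable f \<Longrightarrow> locally_integrable g \<Longrightarrow> locally_integrable (\<lambda>x. f x + g x)"
  unfolding locally_integrable_def by (simp add: set_integral_add)

lemma locally_integrable_diff:
  "locally_integrable f \<Longrightarrow> locally_integrable g \<Longrightarrow> locally_integrable (\<lambda>x. f x - g x)"
  unfolding locally_integrable_def by (simp add: set_integral_diff)

lemma locally_integrable_cmult: "locally_integrable f \<Longrightarrow> locally_integrable (\<lambda>x. c * f x)"
  unfolding locally_integrable_def by simp

lemma locally_integrable_continuous:
  "continuous_on UNIV f \<Longrightarrow> locally_integrable f"
  unfolding locally_integrable_def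
  by (intro allI borel_integrable_atLeastAtMost') (auto intro: continuous_on_subset)

lemma integrable_mult_test:
  assumes f: "locally_integrable f" and \<phi>: "test_function \<phi>"
  shows "integrable lborel (\<lambda>x. f x * \<phi> x)"
proof -
  obtain R where R: "\<And>x. \<bar>x\<bar> > R \<Longrightarrow> \<phi> x = 0"
    using \<phi> by (auto simp: test_function_iff)
  obtain B where "\<And>x. \<bar>\<phi> x\<bar> \<le> B" using test_function_bounded[OF \<phi>] by blast
  then have "locally_integrable (\<lambda>x. f x * \<phi> x)"
    using f \<phi> by (intro locally_integrable_mult_bounded test_function_measurable) auto
  then have "integrable lborel (\<lambda>x. indicator {-R..R} x *\<^sub>R (f x * \<phi> x))"
    unfolding locally_integrable_def set_integrable_def by blast
  also have "(\<lambda>x. indicator {-R..R} x *\<^sub>R (f x * \<phi> x)) = (\<lambda>x. f x * \<phi> x)"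
  proof
    fix x show "indicator {-R..R} x *\<^sub>R (f x * \<phi> x) = f x * \<phi> x"
      using R[of x] by (cases "\<bar>x\<bar> > R") (auto simp: indicator_def abs_le_iff)
  qed
  finally show ?thesis .
qed

text \<open>The Borel sets over which \<open>f\<close> has integral 0 form a Dynkin system
  containing the open intervals, which are stable under intersection and generate the Borel sets. So
  \<open>f\<close> and 0 have the same integral over every Borel set.\<close>

lemma integrable_zero_on_intervals:
  assumes i: "integrable lborel f" and 0: "\<And>a b::real. (LINT x:{a<..<b}|lborel. f x) = (0::real)"
  shows "AE x in lborel. f x = 0"
proof (rule density_unique_real[OF i integrable_zero])
  have si: "set_integrable lborel A f" if "A \<in> sets borel" for A
    using i that unfolding set_integrable_def by (intro integrable_mult_indicator) auto
  \<comment> \<open>Needed for complements; the whole line is not itself an interval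
    \<open>{a<..<b}\<close>, so it is exhausted by such intervals.\<close>
  have all: "(LINT x|lborel. f x) = 0"
  proof -
    have "(\<lambda>n. LINT x|lborel. indicator {-real n<..<real n} x *\<^sub>R f x) \<longlonglongrightarrow> (LINT x|lborel. f x)"
    proof (rule integral_dominated_convergence[where w = "\<lambda>x. norm (f x)"])
      show "AE x in lborel. (\<lambda>n. indicator {-real n<..<real n} x *\<^sub>R f x) \<longlonglongrightarrow> f x"
      proof (rule AE_I2)
        fix x :: real
        have "eventually (\<lambda>n. indicator {-real n<..<real n} x *\<^sub>R f x = f x) sequentially"
          using eventually_ge_at_top[of "Suc (nat \<lceil>\<bar>x\<bar>\<rceil>)"]
          by eventually_elim (simp add: indicator_def, linarith)
        then show "(\<lambda>n. indicator {-real n<..<real n} x *\<^sub>R f x) \<longlonglongrightarrow> f x"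
          by (rule tendsto_eventually)
      qed
    qed (use i in \<open>auto simp: indicator_def\<close>)
    then have "(\<lambda>n. 0) \<longlonglongrightarrow> (LINT x|lborel. f x)"
      using 0 unfolding set_lebesgue_integral_def by simp
    then show ?thesis by (simp add: LIMSEQ_const_iff)
  qed
  fix A :: "real set" assume "A \<in> sets lborel"
  have *: "sigma_sets UNIV (range (\<lambda>(a, b). {a<..<b::real})) = sets borel"
    by (simp add: borel_eq_box)
  with \<open>A \<in> sets lborel\<close> have A: "A \<in> sigma_sets UNIV (range (\<lambda>(a, b). {a<..<b}))" by simp
  have "(LINT x:A|lborel. f x) = 0"
  proof (rule sigma_sets_induct_disjoint[OF _ _ A])
    show "Int_stable (range (\<lambda>(a, b). {a<..<b::real}))"
      by (auto simp: Int_stable_def intro!: image_eqI[where x = "(max _ _, min _ _)"])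
    show "(LINT x:{}|lborel. f x) = 0" by (simp add: set_lebesgue_integral_def)
    show "(LINT x:UNIV - B|lborel. f x) = 0"
      if "B \<in> sigma_sets UNIV (range (\<lambda>(a, b). {a<..<b}))" "(LINT x:B|lborel. f x) = 0" for B
    proof -
      have "(LINT x:B \<union> (UNIV - B)|lborel. f x) = (LINT x:B|lborel. f x) + (LINT x:UNIV - B|lborel. f x)"
        using that * by (intro set_integral_Un si) auto
      with that all show ?thesis by (simp add: set_lebesgue_integral_def)
    qed
    show "(LINT x:(\<Union>i. B i)|lborel. f x) = 0"
      if "disjoint_family B" "range B \<subseteq> sigma_sets UNIV (range (\<lambda>(a, b). {a<..<b}))"
        "\<And>i. (LINT x:B i|lborel. f x) = 0" for B :: "nat \<Rightarrow> real set"
    proof -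
      have B: "B i \<in> sets borel" for i using that(2) * by auto
      then have "(LINT x:(\<Union>i. B i)|lborel. f x) = (\<Sum>i. (LINT x:B i|lborel. f x))"
        using that(1) by (intro lebesgue_integral_countable_add si) (auto simp: disjoint_family_on_def)
      then show ?thesis using that(3) by simp
    qed
  qed (use 0 in auto)
  then show "(LINT x:A|lborel. f x) = (LINT x:A|lborel. 0)" by simp
qed

text \<open>Testing with the bumps and letting them increase to an indicator function shows that the
  integral of \<open>f\<close> over every bounded open interval vanishes. As the supports stay in
  one interval, \<open>f\<close> restricted to it dominates.\<close>

lemma fundamental_lemma:
  assumes f: "locally_integrable f"
    and 0: "\<And>\<phi>. test_function \<phi> \<Longrightarrow> (LINT x|lborel. f x * \<phi> x) = 0"
  shows "AE x in lborel. f x = 0"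
proof -
  have [measurable]: "f \<in> borel_measurable lborel" by (rule locally_integrable_measurable[OF f])
  have int0: "(LINT x:{a<..<b}|lborel. f x) = 0" for a b
  proof -
    have "(\<lambda>n. LINT x|lborel. f x * bump (Suc n) a b x) \<longlonglongrightarrow> (LINT x|lborel. f x * indicator {a<..<b} x)"
    proof (rule integral_dominated_convergence[where w = "\<lambda>x. norm (indicator {a..b} x *\<^sub>R f x)"])
      show "integrable lborel (\<lambda>x. norm (indicator {a..b} x *\<^sub>R f x))"
        using f unfolding locally_integrable_def set_integrable_def by (intro integrable_norm) blast
      show "AE x in lborel. (\<lambda>n. f x * bump (Suc n) a b x) \<longlonglongrightarrow> f x * indicator {a<..<b} x"
        by (intro AE_I2 tendsto_intros bump_tendsto)
      show "AE x in lborel. norm (f x * bump (Suc n) a b x) \<le> norm (indicator {a..b} x *\<^sub>R f x)" for n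
      proof (rule AE_I2)
        fix x
        have "\<bar>bump (Suc n) a b x\<bar> \<le> indicator {a..b} x"
          using bump_bounds[of n a b x] by (cases "a < x \<and> x < b") (auto simp: indicator_def)
        from mult_left_mono[OF this, of "\<bar>f x\<bar>"]
        show "norm (f x * bump (Suc n) a b x) \<le> norm (indicator {a..b} x *\<^sub>R f x)"
          by (simp add: abs_mult mult.commute)
      qed
      show "(\<lambda>x. f x * bump (Suc n) a b x) \<in> borel_measurable lborel" for n
        using test_function_measurable[OF test_function_bump, of n a b] by simp
    qed measurable
    then have "(\<lambda>n. 0) \<longlonglongrightarrow> (LINT x|lborel. f x * indicator {a<..<b} x)"
      using 0[OF test_function_bump] by simp
    then have "(LINT x|lborel. f x * indicator {a<..<b} x) = 0"
      by (simp add: LIMSEQ_const_iff)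
    then show ?thesis
      by (simp add: set_lebesgue_integral_def mult.commute)
  qed
  \<comment> \<open>\<open>f\<close> is integrable only locally, so the criterion on intervals is
    applied to truncations; countably many of them cover the line.\<close>
  have "AE x in lborel. indicator {-real n<..<real n} x * f x = 0" for n
  proof (rule integrable_zero_on_intervals)
    have "set_integrable lborel {-real n..real n} f"
      using f by (simp add: locally_integrable_def)
    then have "set_integrable lborel {-real n<..<real n} f"
      by (rule set_integrable_subset) auto
    then show "integrable lborel (\<lambda>x. indicator {-real n<..<real n} x * f x)"
      by (simp add: set_integrable_def)
    fix a b :: real
    have "(LINT x:{a<..<b}|lborel. indicator {-real n<..<real n} x * f x) =
      (LINT x:{max a (-real n)<..<min b (real n)}|lborel. f x)"
      unfolding set_lebesgue_integral_def
      by (intro Bochner_Integration.integral_cong) (auto simp: indicator_def)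
    then show "(LINT x:{a<..<b}|lborel. indicator {-real n<..<real n} x * f x) = 0"
      using int0 by simp
  qed
  then have "AE x in lborel. \<forall>n. indicator {-real n<..<real n} x * f x = 0"
    by (subst AE_all_countable) blast
  then show ?thesis
  proof (rule AE_mp, intro AE_I2 impI)
    fix x assume *: "\<forall>n. indicator {-real n<..<real n} x * f x = 0"
    obtain n where "\<bar>x\<bar> < real n" using reals_Archimedean2 by blast
    with *[rule_format, of n] show "f x = 0" by (simp add: indicator_def abs_less_iff)
  qed
qed

section \<open>Calculus of weak derivatives\<close>

lemma has_weak_deriv_unique:
  assumes "has_weak_deriv j f g" "has_weak_deriv j f h"
  shows "AE x in lborel. g x = h x"
proof -
  have li: "locally_integrable g" "locally_integrable h" using assms by (auto simp: has_weak_deriv_def)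
  have "AE x in lborel. g x - h x = 0"
  proof (rule fundamental_lemma)
    show "locally_integrable (\<lambda>x. g x - h x)" using li by (rule locally_integrable_diff)
    fix \<phi> assume \<phi>: "test_function \<phi>"
    have "(-1) ^ j * (LINT x|lborel. g x * \<phi> x) = (-1) ^ j * (LINT x|lborel. h x * \<phi> x)"
      using assms[unfolded has_weak_deriv_def, THEN conjunct2, THEN conjunct2, rule_format, OF \<phi>]
      by simp
    then have "(LINT x|lborel. g x * \<phi> x) = (LINT x|lborel. h x * \<phi> x)" by simp
    then show "(LINT x|lborel. (g x - h x) * \<phi> x) = 0"
      using integrable_mult_test[OF li(1) \<phi>] integrable_mult_test[OF li(2) \<phi>]
      by (simp add: left_diff_distrib)
  qed
  then show ?thesis by simp
qed

lemma has_weak_deriv_weak_deriv: "has_weak_deriv j f g \<Longrightarrow> has_weak_deriv j f (weak_deriv j f)"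
  unfolding weak_deriv_def by (rule someI[of "has_weak_deriv j f"])

lemma weak_deriv_AE_eq: "has_weak_deriv j f g \<Longrightarrow> AE x in lborel. weak_deriv j f x = g x"
  using has_weak_deriv_unique has_weak_deriv_weak_deriv by blast

lemma higher_deriv_test: "test_function \<phi> \<Longrightarrow> test_function ((deriv ^^ j) \<phi>)"
  by (induction j) (auto intro: test_function_deriv)

lemma has_weak_deriv_add:
  assumes "has_weak_deriv j f f'" "has_weak_deriv j g g'"
  shows "has_weak_deriv j (\<lambda>x. f x + g x) (\<lambda>x. f' x + g' x)"
  using assms unfolding has_weak_deriv_def
  by (auto simp: distrib_right distrib_left locally_integrable_add integrable_mult_test higher_deriv_test)

lemma has_weak_deriv_cmult:
  assumes "has_weak_deriv j f f'"
  shows "has_weak_deriv j (\<lambda>x. c * f x) (\<lambda>x. c * f' x)"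
  using assms unfolding has_weak_deriv_def
  by (auto simp: mult.assoc locally_integrable_cmult)

lemma has_weak_deriv_diff:
  assumes "has_weak_deriv j f f'" "has_weak_deriv j g g'"
  shows "has_weak_deriv j (\<lambda>x. f x - g x) (\<lambda>x. f' x - g' x)"
  using has_weak_deriv_add[OF assms(1) has_weak_deriv_cmult[OF assms(2), of "-1"]] by simp

lemma locally_integrable_cong_AE:
  assumes "AE x in lborel. f x = g x" "locally_integrable f" "g \<in> borel_measurable lborel"
  shows "locally_integrable g"
  unfolding locally_integrable_def set_integrable_def
proof (intro allI)
  fix a b
  have [measurable]: "g \<in> borel_measurable lborel" "f \<in> borel_measurable lborel"
    using assms locally_integrable_measurable by auto
  have "integrable lborel (\<lambda>x. indicator {a..b} x *\<^sub>R f x) = integrable lborel (\<lambda>x. indicator {a..b} x *\<^sub>R g x)"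
    by (rule integrable_cong_AE) (use assms(1) in auto)
  then show "integrable lborel (\<lambda>x. indicator {a..b} x *\<^sub>R g x)"
    using assms(2) by (simp add: locally_integrable_def set_integrable_def)
qed

text \<open>Measurability of the new representatives is a separate hypothesis because
  \<open>lborel\<close> is not complete: agreeing a.e. with a Borel function does not make a
  function Borel.\<close>

lemma has_weak_deriv_cong_AE:
  assumes "has_weak_deriv j f f'" "AE x in lborel. f x = g x" "AE x in lborel. f' x = g' x"
    "g \<in> borel_measurable lborel" "g' \<in> borel_measurable lborel"
  shows "has_weak_deriv j g g'"
proof -
  have m: "f \<in> borel_measurable lborel" "f' \<in> borel_measurable lborel"
    using assms by (auto simp: has_weak_deriv_def intro!: locally_integrable_measurable[simplified])
  have *: "(LINT x|lborel. f x * \<phi> x) = (LINT x|lborel. g x * \<phi> x)"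
    "(LINT x|lborel. f' x * \<phi> x) = (LINT x|lborel. g' x * \<phi> x)" if "test_function \<phi>" for \<phi>
    using assms m test_function_measurable[OF that] by (auto intro!: integral_cong_AE)
  have "locally_integrable g" "locally_integrable g'"
    using assms locally_integrable_cong_AE by (auto simp: has_weak_deriv_def)
  then show ?thesis
    using assms(1) by (simp add: has_weak_deriv_def higher_deriv_test flip: *)
qed

lemma has_weak_deriv_0: "locally_integrable f \<Longrightarrow> has_weak_deriv 0 f f"
  by (simp add: has_weak_deriv_def)

text \<open>\<open>sobolev\<close> supplies the derivatives of orders 1 and 2 independently of each
  other. Putting the test function \<open>deriv \<phi>\<close> into the first-order identity relates
  them, and the two signs cancel.\<close>

lemma has_weak_deriv_deriv:
  assumes "has_weak_deriv 1 f f'" "has_weak_deriv 2 f f''"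
  shows "has_weak_deriv 1 f' f''"
  unfolding has_weak_deriv_def
proof (intro conjI allI impI)
  fix \<phi> assume \<phi>: "test_function \<phi>"
  have "(LINT x|lborel. f x * deriv (deriv \<phi>) x) = - (LINT x|lborel. f' x * deriv \<phi> x)"
    using assms(1) test_function_deriv[OF \<phi>] by (simp add: has_weak_deriv_def)
  moreover have "(LINT x|lborel. f x * deriv (deriv \<phi>) x) = (LINT x|lborel. f'' x * \<phi> x)"
    using assms(2) \<phi> by (simp add: has_weak_deriv_def numeral_2_eq_2)
  ultimately show "(LINT x|lborel. f' x * (deriv ^^ 1) \<phi> x) = (- 1) ^ 1 * (LINT x|lborel. f'' x * \<phi> x)"
    by simp
qed (use assms in \<open>auto simp: has_weak_deriv_def\<close>)

subsection \<open>Primitives of locally integrable functions\<close>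

text \<open>These are the locally absolutely continuous functions with a.e. derivative
  \<open>f\<close>, encoded by the integral formula alone so that no pointwise differentiation is
  involved.\<close>

definition primitive :: "(real \<Rightarrow> real) \<Rightarrow> (real \<Rightarrow> real) \<Rightarrow> bool" where
  "primitive F f \<longleftrightarrow> locally_integrable f \<and>
     (\<forall>a b. a \<le> b \<longrightarrow> F b - F a = (LINT x:{a..b}|lborel. f x))"

lemma primitiveD: "primitive F f \<Longrightarrow> a \<le> b \<Longrightarrow> (LINT x:{a..b}|lborel. f x) = F b - F a"
  by (simp add: primitive_def)

lemma set_integral_combine:
  fixes f :: "real \<Rightarrow> real"
  assumes f: "locally_integrable f" and ab: "a \<le> b" "b \<le> c"
  shows "(LINT x:{a..c}|lborel. f x) = (LINT x:{a..b}|lborel. f x) + (LINT x:{b..c}|lborel. f x)"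
proof -
  have *: "set_integrable lborel {a..b} f" for a b
    using f by (simp add: locally_integrable_def)
  show ?thesis
    unfolding set_borel_integral_eq_integral(2)[OF *]
    using Henstock_Kurzweil_Integration.integral_combine[OF ab set_borel_integral_eq_integral(1)[OF *]]
    by simp
qed

lemma primitive_exists:
  assumes f: "locally_integrable f"
  obtains F where "primitive F f"
proof
  \<comment> \<open>The integral is over a set and carries no orientation; for negative
    \<open>x\<close> the interval has to be reversed and the sign inserted by hand.\<close>
  define F where "F x = (if 0 \<le> x then (LINT x:{0..x}|lborel. f x) else - (LINT x:{x..0}|lborel. f x))" for x
  show "primitive F f"
    unfolding primitive_def
  proof (intro conjI f allI impI)
    fix a b :: real assume "a \<le> b"
    then consider "0 \<le> a" "a \<le> b" | "a < 0" "0 \<le> b" | "b < 0" "a \<le> b" by linarith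
    then show "F b - F a = (LINT x:{a..b}|lborel. f x)"
    proof cases
      case 1 then show ?thesis using set_integral_combine[OF f, of 0 a b] by (simp add: F_def)
    next
      case 2 then show ?thesis using set_integral_combine[OF f, of a 0 b] by (simp add: F_def)
    next
      case 3 then show ?thesis using set_integral_combine[OF f, of a b 0] by (simp add: F_def)
    qed
  qed
qed

lemma primitive_continuous:
  assumes F: "primitive F f"
  shows "continuous_on UNIV F"
proof -
  have si: "set_integrable lborel {a..b} f" for a b
    using F by (simp add: primitive_def locally_integrable_def)
  have "isCont F x" for x
  proof -
    \<comment> \<open>Starting the integral at \<open>x-1\<close> makes \<open>x\<close> an interior
      point of an interval on which one formula for \<open>F\<close> is valid.\<close>
    have "continuous_on {x-1..x+1} (\<lambda>y. F (x-1) + integral {x-1..y} f)"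
      by (intro continuous_intros indefinite_integral_continuous_1 set_borel_integral_eq_integral(1) si)
    also have "continuous_on {x-1..x+1} (\<lambda>y. F (x-1) + integral {x-1..y} f) \<longleftrightarrow> continuous_on {x-1..x+1} F"
      using primitiveD[OF F] set_borel_integral_eq_integral(2)[OF si]
      by (intro continuous_on_cong) auto
    finally show ?thesis
      by (rule continuous_on_interior) auto
  qed
  then show ?thesis by (simp add: continuous_on_eq_continuous_at)
qed

lemma primitive_measurable: "primitive F f \<Longrightarrow> F \<in> borel_measurable borel"
  by (simp add: borel_measurable_continuous_onI primitive_continuous)

lemma primitive_C1:
  assumes d: "\<And>x. (F has_real_derivative f x) (at x)" and f: "continuous_on UNIV f"
  shows "primitive F f"
  unfolding primitive_def
proof (intro conjI allI impI)
  show "locally_integrable f" by (rule locally_integrable_continuous[OF f])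
  fix a b :: real assume "a \<le> b"
  then show "F b - F a = (LINT x:{a..b}|lborel. f x)"
    unfolding set_lebesgue_integral_def
    using d f
    by (intro integral_FTC_atLeastAtMost[symmetric])
      (auto intro: continuous_on_subset has_vector_derivative_at_within
            simp: has_real_derivative_iff_has_vector_derivative)
qed

lemma locally_integrable_mult_continuous:
  assumes "locally_integrable f" "continuous_on UNIV g"
  shows "locally_integrable (\<lambda>x. f x * g x)"
proof (rule locally_integrable_mult_bounded)
  fix a b :: real
  have "bounded (g ` {a..b})"
    using assms by (intro compact_imp_bounded compact_continuous_image) (auto intro: continuous_on_subset)
  then show "\<exists>B. \<forall>x\<in>{a..b}. \<bar>g x\<bar> \<le> B" by (auto simp: bounded_iff)
qed (use assms in \<open>auto simp: borel_measurable_continuous_onI\<close>)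

text \<open>Both sides integrate the same kernel, cut off to y \<le> x, in the two orders. The uncut
  product is integrable on the plane and dominates it, so Fubini applies.\<close>

lemma integral_triangle_swap:
  fixes f g :: "real \<Rightarrow> real"
  assumes f: "integrable lborel f" and g: "integrable lborel g"
  shows "(LINT x|lborel. f x * (LINT y|lborel. (if y \<le> x then g y else 0))) =
    (LINT y|lborel. g y * (LINT x|lborel. (if y \<le> x then f x else 0)))"
proof -
  have [measurable]: "f \<in> borel_measurable borel" "g \<in> borel_measurable borel"
    using f g by (auto dest: borel_measurable_integrable)
  define H where "H x y = f x * (if y \<le> x then g y else 0)" for x y
  have "integrable (lborel \<Otimes>\<^sub>M lborel) (\<lambda>p. f (fst p) * g (snd p))"
  proof (rule lborel_pair.Fubini_integrable)
    show "AE x in lborel. integrable lborel (\<lambda>y. f (fst (x, y)) * g (snd (x, y)))"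
      using g by simp
    show "integrable lborel (\<lambda>x. LINT y|lborel. norm (f (fst (x, y)) * g (snd (x, y))))"
      using f g by (simp add: abs_mult)
  qed measurable
  then have "integrable (lborel \<Otimes>\<^sub>M lborel) (case_prod H)"
  proof (rule Bochner_Integration.integrable_bound)
    show "case_prod H \<in> borel_measurable (lborel \<Otimes>\<^sub>M lborel)"
      unfolding H_def split_beta by measurable
  qed (auto simp: H_def split_beta)
  then have "(LINT y|lborel. LINT x|lborel. H x y) = (LINT x|lborel. LINT y|lborel. H x y)"
    by (rule lborel_pair.Fubini_integral)
  moreover have "(LINT x|lborel. H x y) = g y * (LINT x|lborel. (if y \<le> x then f x else 0))" for y
  proof -
    have "H x y = g y * (if y \<le> x then f x else 0)" for x by (simp add: H_def)
    then show ?thesis by simp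
  qed
  ultimately show ?thesis
    by (simp add: H_def)
qed

text \<open>No pointwise derivative is available; the product rule is Fubini's theorem for
  \<open>f x * g y\<close> on the triangle \<open>y \<le> x\<close>.\<close>

lemma primitive_mult:
  assumes F: "primitive F f" and G: "primitive G g"
  shows "primitive (\<lambda>x. F x * G x) (\<lambda>x. f x * G x + F x * g x)"
proof -
  have li: "locally_integrable f" "locally_integrable g" using F G by (auto simp: primitive_def)
  have fG: "locally_integrable (\<lambda>x. f x * G x)" and gF: "locally_integrable (\<lambda>x. F x * g x)"
    using locally_integrable_mult_continuous[OF li(1) primitive_continuous[OF G]]
      locally_integrable_mult_continuous[OF li(2) primitive_continuous[OF F]]
    by (simp_all add: mult.commute)
  show ?thesis
    unfolding primitive_def
  proof (intro conjI allI impI locally_integrable_add fG gF)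
    fix a b :: real assume ab: "a \<le> b"
    define I where "I h = (LINT x|lborel. indicator {a..b} x * h x)" for h :: "real \<Rightarrow> real"
    have si: "integrable lborel (\<lambda>x. indicator {a..b} x * h x)" if "locally_integrable h" for h
      using that by (simp add: locally_integrable_def set_integrable_def)
    have If: "I f = F b - F a" and Ig: "I g = G b - G a"
      using primitiveD[OF F ab] primitiveD[OF G ab] by (simp_all add: I_def set_lebesgue_integral_def)
    \<comment> \<open>With both functions truncated to \<open>{a..b}\<close>, the inner integral
      over y \<le> x is \<open>G x - G a\<close>, and in the other order it is
      \<open>F b - F y\<close>. Equating the two results leaves the product rule with its boundary
      terms.\<close>
    have "(LINT x|lborel. (indicator {a..b} x * f x) *
          (LINT y|lborel. (if y \<le> x then indicator {a..b} y * g y else 0))) =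
        (LINT x|lborel. indicator {a..b} x * (f x * G x) - G a * (indicator {a..b} x * f x))"
    proof (rule Bochner_Integration.integral_cong[OF refl])
      fix x
      have *: "(LINT y|lborel. (if y \<le> x then indicator {a..b} y * g y else 0)) = G x - G a"
        if "a \<le> x" "x \<le> b"
        unfolding primitiveD[OF G that(1), symmetric] set_lebesgue_integral_def
        using that by (intro Bochner_Integration.integral_cong) (auto simp: indicator_def)
      show "(indicator {a..b} x * f x) *
          (LINT y|lborel. (if y \<le> x then indicator {a..b} y * g y else 0)) =
        indicator {a..b} x * (f x * G x) - G a * (indicator {a..b} x * f x)"
        by (cases "a \<le> x \<and> x \<le> b") (auto simp: * right_diff_distrib)
    qed
    also have "\<dots> = I (\<lambda>x. f x * G x) - G a * (F b - F a)"
      using If by (subst Bochner_Integration.integral_diff) (auto simp: I_def intro!: si fG li)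
    finally have 1: "(LINT x|lborel. (indicator {a..b} x * f x) *
          (LINT y|lborel. (if y \<le> x then indicator {a..b} y * g y else 0))) =
          I (\<lambda>x. f x * G x) - G a * (F b - F a)" .
    have "(LINT y|lborel. (indicator {a..b} y * g y) *
          (LINT x|lborel. (if y \<le> x then indicator {a..b} x * f x else 0))) =
        (LINT y|lborel. F b * (indicator {a..b} y * g y) - indicator {a..b} y * (F y * g y))"
    proof (rule Bochner_Integration.integral_cong[OF refl])
      fix y
      have *: "(LINT x|lborel. (if y \<le> x then indicator {a..b} x * f x else 0)) = F b - F y"
        if "a \<le> y" "y \<le> b"
        unfolding primitiveD[OF F that(2), symmetric] set_lebesgue_integral_def
        using that by (intro Bochner_Integration.integral_cong) (auto simp: indicator_def)
      show "(indicator {a..b} y * g y) *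
          (LINT x|lborel. (if y \<le> x then indicator {a..b} x * f x else 0)) =
        F b * (indicator {a..b} y * g y) - indicator {a..b} y * (F y * g y)"
        by (cases "a \<le> y \<and> y \<le> b") (auto simp: * right_diff_distrib)
    qed
    also have "\<dots> = F b * (G b - G a) - I (\<lambda>x. F x * g x)"
      using Ig by (subst Bochner_Integration.integral_diff) (auto simp: I_def intro!: si gF li)
    finally have 2: "(LINT y|lborel. (indicator {a..b} y * g y) *
          (LINT x|lborel. (if y \<le> x then indicator {a..b} x * f x else 0))) =
          F b * (G b - G a) - I (\<lambda>x. F x * g x)" .
    have 3: "I (\<lambda>x. f x * G x) - G a * (F b - F a) = F b * (G b - G a) - I (\<lambda>x. F x * g x)"
      using integral_triangle_swap[OF si[OF li(1)] si[OF li(2)]] 1 2 by simp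
    have "(LINT x:{a..b}|lborel. f x * G x + F x * g x) = I (\<lambda>x. f x * G x) + I (\<lambda>x. F x * g x)"
      using si[OF fG] si[OF gF]
      by (simp add: set_lebesgue_integral_def I_def distrib_left)
    then show "F b * G b - F a * G a = (LINT x:{a..b}|lborel. f x * G x + F x * g x)"
      using 3 by (simp add: algebra_simps)
  qed
qed

lemma primitive_test: "test_function \<phi> \<Longrightarrow> primitive \<phi> (deriv \<phi>)"
  by (intro primitive_C1 test_function_has_deriv test_function_continuous test_function_deriv)

text \<open>The product rule for \<open>F\<close> times \<open>\<phi>\<close> on an interval outside
  which \<open>\<phi>\<close> vanishes is the weak identity, since the boundary terms are 0.\<close>

lemma primitive_has_weak_deriv:
  assumes F: "primitive F f"
  shows "has_weak_deriv 1 F f"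
  unfolding has_weak_deriv_def
proof (intro conjI allI impI)
  show f: "locally_integrable f" using F by (simp add: primitive_def)
  show lF: "locally_integrable F" by (rule locally_integrable_continuous[OF primitive_continuous[OF F]])
  fix \<phi> assume \<phi>: "test_function \<phi>"
  then obtain R0 where R0: "\<And>x. \<bar>x\<bar> > R0 \<Longrightarrow> \<phi> x = 0"
    by (auto simp: test_function_iff)
  obtain R1 where R1: "\<And>x. \<bar>x\<bar> > R1 \<Longrightarrow> deriv \<phi> x = 0"
    using test_function_deriv[OF \<phi>] by (auto simp: test_function_iff)
  \<comment> \<open>The bounds \<open>R0\<close> and \<open>R1\<close> give zeros only strictly
    beyond them; the added 1 makes \<open>\<phi>\<close> and \<open>deriv \<phi>\<close> vanish at
    the end points as well.\<close>
  define R where "R = \<bar>R0\<bar> + \<bar>R1\<bar> + 1"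
  have R: "\<phi> x = 0" "deriv \<phi> x = 0" if "\<bar>x\<bar> \<ge> R" for x
    using that R0[of x] R1[of x] by (auto simp: R_def)
  have "R \<ge> 0" by (simp add: R_def)
  have i: "integrable lborel (\<lambda>x. f x * \<phi> x)" "integrable lborel (\<lambda>x. F x * deriv \<phi> x)"
    by (auto intro: integrable_mult_test f lF \<phi> test_function_deriv)
  have "(LINT x:{-R..R}|lborel. f x * \<phi> x + F x * deriv \<phi> x) = F R * \<phi> R - F (-R) * \<phi> (-R)"
    using \<open>R \<ge> 0\<close> by (intro primitiveD[OF primitive_mult[OF F primitive_test[OF \<phi>]]]) simp
  also have "\<dots> = 0" using R[of R] R[of "-R"] \<open>R \<ge> 0\<close> by simp
  also have "(LINT x:{-R..R}|lborel. f x * \<phi> x + F x * deriv \<phi> x) = (LINT x|lborel. f x * \<phi> x + F x * deriv \<phi> x)"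
    unfolding set_lebesgue_integral_def
  proof (rule Bochner_Integration.integral_cong[OF refl])
    fix x show "indicator {-R..R} x *\<^sub>R (f x * \<phi> x + F x * deriv \<phi> x) = f x * \<phi> x + F x * deriv \<phi> x"
      using R[of x] by (cases "\<bar>x\<bar> \<ge> R") (auto simp: indicator_def)
  qed
  also have "\<dots> = (LINT x|lborel. f x * \<phi> x) + (LINT x|lborel. F x * deriv \<phi> x)"
    using i by simp
  finally show "(LINT x|lborel. F x * (deriv ^^ 1) \<phi> x) = (- 1) ^ 1 * (LINT x|lborel. f x * \<phi> x)"
    by simp
qed

text \<open>The antiderivative that is 0 to the left of the support equals the total integral of
  \<open>\<psi>\<close> to the right of it. Mean zero is exactly what makes it compactly
  supported.\<close>

lemma test_function_primitive:
  assumes \<psi>: "test_function \<psi>" and 0: "(LINT x|lborel. \<psi> x) = 0"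
  obtains \<phi> where "test_function \<phi>" "deriv \<phi> = \<psi>"
proof -
  have \<psi>c: "continuous_on A \<psi>" for A using \<psi> by (rule test_function_continuous)
  obtain F0 where F0: "primitive F0 \<psi>"
    using primitive_exists[OF locally_integrable_continuous[OF \<psi>c]] by blast
  obtain R0 where R0: "\<And>x. \<bar>x\<bar> > R0 \<Longrightarrow> \<psi> x = 0"
    using \<psi> by (auto simp: test_function_iff)
  define R where "R = \<bar>R0\<bar> + 1"
  have R: "\<psi> x = 0" if "\<bar>x\<bar> \<ge> R" for x using that R0[of x] by (auto simp: R_def)
  have "R > 0" by (simp add: R_def)
  define \<phi> where "\<phi> x = F0 x - F0 (-R)" for x
  have \<phi>: "primitive \<phi> \<psi>" using F0 by (simp add: primitive_def \<phi>_def)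
  have d: "(\<phi> has_real_derivative \<psi> x) (at x)" for x
  proof -
    have "((\<lambda>u. integral {x-1..u} \<psi>) has_vector_derivative \<psi> x) (at x within {x-1..x+1})"
      by (rule integral_has_vector_derivative[OF \<psi>c]) simp
    then have "((\<lambda>u. integral {x-1..u} \<psi>) has_real_derivative \<psi> x) (at x)"
      by (simp add: has_real_derivative_iff_has_vector_derivative at_within_Icc_at)
    then have "((\<lambda>u. \<phi> (x-1) + integral {x-1..u} \<psi>) has_real_derivative \<psi> x) (at x)"
      by (auto intro!: derivative_eq_intros)
    moreover have "eventually (\<lambda>u. \<phi> (x-1) + integral {x-1..u} \<psi> = \<phi> u) (nhds x)"
      using eventually_nhds_in_open[of "{x-1<..}" x, OF open_greaterThan]
    proof (rule eventually_mono)
      fix u assume "u \<in> {x-1<..}"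
      then show "\<phi> (x-1) + integral {x-1..u} \<psi> = \<phi> u"
        using primitiveD[OF \<phi>, of "x-1" u]
          set_borel_integral_eq_integral(2)[OF borel_integrable_atLeastAtMost'[OF \<psi>c], of "x-1" u] by simp
    qed simp
    ultimately show ?thesis by (simp cong: DERIV_cong_ev)
  qed
  then have dd: "deriv \<phi> = \<psi>" by (auto intro: DERIV_imp_deriv)
  have "times_differentiable n \<phi>" for n
  proof (cases n)
    case (Suc m)
    have "times_differentiable m \<psi>" using \<psi> by (simp add: test_function_iff)
    with d have "times_differentiable (Suc m) \<phi>"
      unfolding times_differentiable.simps(2) by blast
    with Suc show ?thesis by simp
  qed simp
  moreover have "\<phi> x = 0" if "\<bar>x\<bar> > R" for x
  proof (cases "x > 0")
    case True
    then have "\<phi> x - \<phi> (-R) = (LINT y:{-R..x}|lborel. \<psi> y)"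
      using \<open>R > 0\<close> by (intro primitiveD[OF \<phi>, symmetric]) simp
    also have "\<dots> = (LINT y|lborel. \<psi> y)"
      unfolding set_lebesgue_integral_def
    proof (rule Bochner_Integration.integral_cong[OF refl])
      fix y show "indicator {-R..x} y *\<^sub>R \<psi> y = \<psi> y"
        using R[of y] True that by (cases "\<bar>y\<bar> \<ge> R") (auto simp: indicator_def)
    qed
    finally show ?thesis using 0 by (simp add: \<phi>_def)
  next
    case False
    then have "\<phi> (-R) - \<phi> x = (LINT y:{x..-R}|lborel. \<psi> y)"
      using that by (intro primitiveD[OF \<phi>, symmetric]) simp
    also have "\<dots> = (LINT y|(lborel :: real measure). 0)"
      unfolding set_lebesgue_integral_def
    proof (rule Bochner_Integration.integral_cong[OF refl])
      fix y show "indicator {x..-R} y *\<^sub>R \<psi> y = 0"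
        using R[of y] \<open>R > 0\<close> by (auto simp: indicator_def)
    qed
    finally show ?thesis by (simp add: \<phi>_def)
  qed
  ultimately have "test_function \<phi>" unfolding test_function_iff by blast
  with dd show ?thesis using that by blast
qed

text \<open>A test function is the derivative of a test function iff its integral vanishes; the bump
  \<open>b\<close> serves to correct the integral.\<close>

lemma du_Bois_Reymond:
  assumes d: "has_weak_deriv 1 d (\<lambda>x. 0)"
  obtains c where "AE x in lborel. d x = c"
proof -
  have dl: "locally_integrable d" using d by (simp add: has_weak_deriv_def)
  define b where "b = bump (Suc 0) 0 1"
  have b: "test_function b" unfolding b_def by (rule test_function_bump)
  have bi: "integrable lborel b"
    using integrable_mult_test[OF locally_integrable_continuous[of "\<lambda>x. 1"] b] by simp
  have "(LINT x|lborel. b x) \<noteq> 0"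
  proof
    assume "(LINT x|lborel. b x) = 0"
    then have "AE x in lborel. b x = 0"
      using integral_nonneg_eq_0_iff_AE[OF bi] bump_bounds by (simp add: b_def)
    moreover have "b x \<noteq> 0" if "x \<in> {0<..<1}" for x using that by (simp add: b_def bump_eq)
    ultimately have "AE x in lborel. x \<notin> {0<..<1::real}" by (auto elim!: eventually_mono)
    then have "emeasure lborel {0<..<1::real} = 0"
      by (subst (asm) AE_iff_measurable[of "{0<..<1}"]) auto
    moreover have "emeasure lborel {0<..<1::real} = 1" by simp
    ultimately show False by simp
  qed
  \<comment> \<open>The only possible value: if \<open>d\<close> is constant, integrating it against
    \<open>b\<close> determines the constant.\<close>
  define c where "c = (LINT x|lborel. d x * b x) / (LINT x|lborel. b x)"
  have "AE x in lborel. d x - c = 0"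
  proof (rule fundamental_lemma)
    have lc: "locally_integrable (\<lambda>x. c)" by (rule locally_integrable_continuous) simp
    show "locally_integrable (\<lambda>x. d x - c)" by (intro locally_integrable_diff dl lc)
    fix \<psi> assume \<psi>: "test_function \<psi>"
    have \<psi>i: "integrable lborel \<psi>"
      using integrable_mult_test[OF locally_integrable_continuous[of "\<lambda>x. 1"] \<psi>] by simp
    \<comment> \<open>Chosen so that \<open>\<psi>\<close> minus \<open>k\<close> times
      \<open>b\<close> has mean zero and hence is the derivative of a test function, against which
      \<open>d\<close> integrates to 0.\<close>
    define k where "k = (LINT x|lborel. \<psi> x) / (LINT x|lborel. b x)"
    have "test_function (\<lambda>x. b x * (- k))"
      by (intro test_function_mult b times_differentiable_const)
    then have t: "test_function (\<lambda>x. \<psi> x + b x * (- k))" by (rule test_function_add[OF \<psi>])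
    have "(LINT x|lborel. \<psi> x + b x * (- k)) = 0"
      using \<psi>i bi \<open>(LINT x|lborel. b x) \<noteq> 0\<close> by (simp add: k_def)
    then obtain \<phi> where \<phi>: "test_function \<phi>" "deriv \<phi> = (\<lambda>x. \<psi> x + b x * (- k))"
      using test_function_primitive[OF t] by blast
    have "(LINT x|lborel. d x * (\<psi> x + b x * (- k))) = 0"
      using d \<phi> unfolding has_weak_deriv_def by fastforce
    also have "(LINT x|lborel. d x * (\<psi> x + b x * (- k))) = (LINT x|lborel. d x * \<psi> x - k * (d x * b x))"
      by (simp add: algebra_simps)
    also have "\<dots> = (LINT x|lborel. d x * \<psi> x) - k * (LINT x|lborel. d x * b x)"
      using integrable_mult_test[OF dl \<psi>] integrable_mult_test[OF dl b] by simp
    also have "\<dots> = (LINT x|lborel. d x * \<psi> x) - c * (LINT x|lborel. \<psi> x)"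
      by (simp add: c_def k_def)
    also have "\<dots> = (LINT x|lborel. (d x - c) * \<psi> x)"
      using integrable_mult_test[OF dl \<psi>] \<psi>i by (simp add: left_diff_distrib)
    finally show "(LINT x|lborel. (d x - c) * \<psi> x) = 0" .
  qed
  then show ?thesis using that[of c] by simp
qed

text \<open>Source of the absolutely continuous representative: any primitive \<open>G\<close> of
  \<open>g\<close> has the same weak derivative as \<open>f\<close>, so they differ by a constant,
  which is absorbed into the primitive.\<close>

lemma has_weak_deriv_primitive:
  assumes fg: "has_weak_deriv 1 f g"
  obtains F where "primitive F g" "AE x in lborel. f x = F x"
proof -
  obtain G where G: "primitive G g"
    using primitive_exists fg by (auto simp: has_weak_deriv_def)
  have "has_weak_deriv 1 (\<lambda>x. f x - G x) (\<lambda>x. 0)"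
    using has_weak_deriv_diff[OF fg primitive_has_weak_deriv[OF G]] by simp
  then obtain c where c: "AE x in lborel. f x - G x = c" by (rule du_Bois_Reymond)
  show ?thesis
  proof
    show "primitive (\<lambda>x. G x + c) g" using G by (simp add: primitive_def)
    show "AE x in lborel. f x = G x + c" using c by (auto elim!: eventually_mono)
  qed
qed

section \<open>Primitives at infinity\<close>

lemma integrable_limit_at_top_eq_0:
  fixes F :: "real \<Rightarrow> real"
  assumes F: "integrable lborel F" and L: "(F \<longlongrightarrow> L) at_top"
  shows "L = 0"
proof (rule ccontr)
  assume "L \<noteq> 0"
  then have "eventually (\<lambda>x. dist (F x) L < \<bar>L\<bar> / 2) at_top"
    using L by (intro tendstoD) auto
  then obtain B where B: "\<And>x. x \<ge> B \<Longrightarrow> dist (F x) L < \<bar>L\<bar> / 2"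
    by (auto simp: eventually_at_top_linorder)
  have le: "\<bar>L\<bar> / 2 \<le> \<bar>F x\<bar>" if "x \<ge> B" for x
    using B[OF that] unfolding dist_real_def by linarith
  \<comment> \<open>A nonzero limit keeps the absolute value of \<open>F\<close> above half of that
    of \<open>L\<close> on a half-line, so its integral would exceed every multiple of that
    number.\<close>
  have bd: "real n * (\<bar>L\<bar> / 2) \<le> (LINT x|lborel. \<bar>F x\<bar>)" for n
  proof -
    have "(LINT x|lborel. (\<bar>L\<bar> / 2) * indicator {B..B + real n} x) \<le> (LINT x|lborel. \<bar>F x\<bar>)"
    proof (rule integral_mono)
      show "integrable lborel (\<lambda>x. (\<bar>L\<bar> / 2) * indicator {B..B + real n} x)"
        by (intro integrable_mult_right integrable_real_indicator) auto
    qed (use F le in \<open>auto simp: indicator_def\<close>)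
    then show ?thesis by (simp add: mult.commute)
  qed
  obtain n where "(LINT x|lborel. \<bar>F x\<bar>) / (\<bar>L\<bar> / 2) < real n" using reals_Archimedean2 by blast
  with bd[of n] \<open>L \<noteq> 0\<close> show False by (simp add: field_simps)
qed

text \<open>Integrability of \<open>f\<close> makes the limit exist; integrability of
  \<open>F\<close> forces it to be 0.\<close>

lemma primitive_tendsto_at_top:
  assumes F: "primitive F f" and f: "integrable lborel f" and FI: "integrable lborel F"
  shows "(F \<longlongrightarrow> 0) at_top"
proof -
  have [measurable]: "f \<in> borel_measurable borel" using f by (auto dest: borel_measurable_integrable)
  have "((\<lambda>b. LINT x|lborel. indicator {0..b} x * f x) \<longlongrightarrow> (LINT x|lborel. indicator {0..} x * f x)) at_top"
  proof (rule integral_dominated_convergence_at_top[where w = "\<lambda>x. \<bar>f x\<bar>"])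
    show "AE x in lborel. ((\<lambda>b. indicator {0..b} x * f x) \<longlongrightarrow> indicator {0..} x * f x) at_top"
    proof (rule AE_I2)
      fix x :: real
      have "eventually (\<lambda>b. indicator {0..b} x * f x = indicator {0..} x * f x) at_top"
        using eventually_ge_at_top[of x] by eventually_elim (auto simp: indicator_def)
      then show "((\<lambda>b. indicator {0..b} x * f x) \<longlongrightarrow> indicator {0..} x * f x) at_top"
        by (rule tendsto_eventually)
    qed
    show "eventually (\<lambda>b. AE x in lborel. norm (indicator {0..b} x * f x) \<le> \<bar>f x\<bar>) at_top"
      by (intro always_eventually allI AE_I2) (auto simp: indicator_def)
  qed (use f in auto)
  then have "((\<lambda>b. F 0 + (LINT x|lborel. indicator {0..b} x * f x)) \<longlongrightarrow>
      F 0 + (LINT x|lborel. indicator {0..} x * f x)) at_top"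
    by (intro tendsto_intros)
  moreover have "eventually (\<lambda>b. F 0 + (LINT x|lborel. indicator {0..b} x * f x) = F b) at_top"
    using eventually_ge_at_top[of 0]
    by eventually_elim (use primitiveD[OF F, of 0] in \<open>simp add: set_lebesgue_integral_def\<close>)
  ultimately have lim: "(F \<longlongrightarrow> F 0 + (LINT x|lborel. indicator {0..} x * f x)) at_top"
    by (rule Lim_transform_eventually)
  with integrable_limit_at_top_eq_0[OF FI lim] show ?thesis by simp
qed

lemma primitive_reflect:
  assumes F: "primitive F f"
  shows "primitive (\<lambda>x. F (- x)) (\<lambda>x. - f (- x))"
proof -
  have *: "indicator {a..b} (- x) = (indicator {-b..-a} x :: real)" for a b x :: real
    by (auto simp: indicator_def)
  show ?thesis
    unfolding primitive_def locally_integrable_def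
  proof (intro conjI allI impI)
    fix a b :: real
    have "integrable lborel (\<lambda>x. indicator {-b..-a} x *\<^sub>R f x)"
      using F by (auto simp: primitive_def locally_integrable_def set_integrable_def)
    from lborel_integrable_real_affine[OF this, of "-1" 0]
    show "set_integrable lborel {a..b} (\<lambda>x. - f (- x))"
      by (simp add: set_integrable_def *)
    assume "a \<le> b"
    then have "F (-a) - F (-b) = (LINT x|lborel. indicator {-b..-a} x *\<^sub>R f x)"
      using primitiveD[OF F, of "-b" "-a"] by (simp add: set_lebesgue_integral_def)
    also have "\<dots> = (LINT x|lborel. indicator {a..b} x * f (- x))"
      using lborel_integral_real_affine[of "-1" "\<lambda>x. indicator {-b..-a} x *\<^sub>R f x" 0] by (simp add: *)
    finally show "F (- b) - F (- a) = (LINT x:{a..b}|lborel. - f (- x))"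
      by (simp add: set_lebesgue_integral_def)
  qed
qed

lemma primitive_tendsto_at_bot:
  assumes F: "primitive F f" and f: "integrable lborel f" and FI: "integrable lborel F"
  shows "(F \<longlongrightarrow> 0) at_bot"
proof -
  have "((\<lambda>x. F (- x)) \<longlongrightarrow> 0) at_top"
    using lborel_integrable_real_affine[OF f, of "-1" 0] lborel_integrable_real_affine[OF FI, of "-1" 0]
    by (intro primitive_tendsto_at_top[OF primitive_reflect[OF F]]) auto
  then show ?thesis by (simp add: filterlim_at_bot_mirror)
qed

text \<open>The integral is the limit of \<open>F b - F (-b)\<close>, and both terms tend to 0.
  Applied to a product of primitives, this is integration by parts on the whole line.\<close>

lemma primitive_integral_eq_0:
  assumes F: "primitive F f" and f: "integrable lborel f" and FI: "integrable lborel F"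
  shows "(LINT x|lborel. f x) = 0"
proof -
  have [measurable]: "f \<in> borel_measurable borel" using f by (auto dest: borel_measurable_integrable)
  have "((\<lambda>b. LINT x|lborel. indicator {-b..b} x * f x) \<longlongrightarrow> (LINT x|lborel. f x)) at_top"
  proof (rule integral_dominated_convergence_at_top[where w = "\<lambda>x. \<bar>f x\<bar>"])
    show "AE x in lborel. ((\<lambda>b. indicator {-b..b} x * f x) \<longlongrightarrow> f x) at_top"
    proof (rule AE_I2)
      fix x :: real
      have "eventually (\<lambda>b. indicator {-b..b} x * f x = f x) at_top"
        using eventually_ge_at_top[of "\<bar>x\<bar>"] by eventually_elim (auto simp: indicator_def)
      then show "((\<lambda>b. indicator {-b..b} x * f x) \<longlongrightarrow> f x) at_top"
        by (rule tendsto_eventually)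
    qed
    show "eventually (\<lambda>b. AE x in lborel. norm (indicator {-b..b} x * f x) \<le> \<bar>f x\<bar>) at_top"
      by (intro always_eventually allI AE_I2) (auto simp: indicator_def)
  qed (use f in auto)
  moreover have "eventually (\<lambda>b. (LINT x|lborel. indicator {-b..b} x * f x) = F b - F (-b)) at_top"
    using eventually_ge_at_top[of 0]
    by eventually_elim (use primitiveD[OF F] in \<open>simp add: set_lebesgue_integral_def\<close>)
  ultimately have "((\<lambda>b. F b - F (-b)) \<longlongrightarrow> (LINT x|lborel. f x)) at_top"
    by (rule Lim_transform_eventually)
  moreover have "((\<lambda>b. F b - F (-b)) \<longlongrightarrow> 0 - 0) at_top"
    using primitive_tendsto_at_bot[OF assms] unfolding filterlim_at_bot_mirror
    by (intro tendsto_diff primitive_tendsto_at_top[OF assms])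
  ultimately show ?thesis
    using tendsto_unique[of "at_top :: real filter" "\<lambda>b. F b - F (-b)"] by simp
qed

text \<open>As \<open>F\<close> vanishes at infinity, \<open>F x\<close> is minus the integral of
  \<open>f\<close> over the half-line beyond \<open>x\<close>.\<close>

lemma primitive_sup_bound:
  assumes F: "primitive F f" and f: "integrable lborel f" and FI: "integrable lborel F"
  shows "\<bar>F x\<bar> \<le> (LINT x|lborel. \<bar>f x\<bar>)"
proof -
  have "\<bar>F x - F b\<bar> \<le> (LINT x|lborel. \<bar>f x\<bar>)" if "b \<ge> x" for b
  proof -
    have "\<bar>F x - F b\<bar> = \<bar>LINT y|lborel. indicator {x..b} y * f y\<bar>"
      using primitiveD[OF F that] by (simp add: set_lebesgue_integral_def abs_minus_commute)
    also have "\<dots> \<le> (LINT y|lborel. \<bar>indicator {x..b} y * f y\<bar>)"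
      by (rule integral_abs_bound)
    also have "\<dots> \<le> (LINT x|lborel. \<bar>f x\<bar>)"
    proof (rule integral_mono)
      show "integrable lborel (\<lambda>y. \<bar>indicator {x..b} y * f y\<bar>)"
        using F by (auto simp: primitive_def locally_integrable_def set_integrable_def)
    qed (use f in \<open>auto simp: indicator_def\<close>)
    finally show ?thesis .
  qed
  then have "eventually (\<lambda>b. \<bar>F x - F b\<bar> \<le> (LINT x|lborel. \<bar>f x\<bar>)) at_top"
    using eventually_ge_at_top[of x] by (rule eventually_mono[rotated]) simp
  moreover have "((\<lambda>b. \<bar>F x - F b\<bar>) \<longlongrightarrow> \<bar>F x - 0\<bar>) at_top"
    by (intro tendsto_intros primitive_tendsto_at_top[OF assms])
  ultimately show ?thesis
    using tendsto_upperbound[of "\<lambda>b. \<bar>F x - F b\<bar>" "\<bar>F x - 0\<bar>" at_top] by simp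
qed

subsection \<open>Square integrable functions\<close>

lemma square_integrable_measurable [measurable_dest]:
  "square_integrable f \<Longrightarrow> f \<in> borel_measurable borel"
  by (simp add: square_integrable_def)

lemma square_integrable_square: "square_integrable f \<Longrightarrow> integrable lborel (\<lambda>x. (f x)\<^sup>2)"
  by (simp add: square_integrable_def)

lemma square_integrable_mult_integrable:
  assumes f: "square_integrable f" and g: "square_integrable g"
  shows "integrable lborel (\<lambda>x. f x * g x)"
proof (rule Bochner_Integration.integrable_bound)
  show "integrable lborel (\<lambda>x. (f x)\<^sup>2 + (g x)\<^sup>2)"
    using assms by (simp add: square_integrable_def)
  show "(\<lambda>x. f x * g x) \<in> borel_measurable lborel" using assms by measurable
  show "AE x in lborel. norm (f x * g x) \<le> norm ((f x)\<^sup>2 + (g x)\<^sup>2)"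
  proof (rule AE_I2)
    fix x
    have "2 * \<bar>f x\<bar> * \<bar>g x\<bar> \<le> (f x)\<^sup>2 + (g x)\<^sup>2"
      using sum_squares_bound[of "\<bar>f x\<bar>" "\<bar>g x\<bar>"] by simp
    moreover have "0 \<le> \<bar>f x\<bar> * \<bar>g x\<bar>" by simp
    ultimately have "\<bar>f x\<bar> * \<bar>g x\<bar> \<le> (f x)\<^sup>2 + (g x)\<^sup>2" by linarith
    then show "norm (f x * g x) \<le> norm ((f x)\<^sup>2 + (g x)\<^sup>2)"
      by (simp add: abs_mult)
  qed
qed

lemma square_integrable_cmult: "square_integrable f \<Longrightarrow> square_integrable (\<lambda>x. c * f x)"
  by (auto simp: square_integrable_def power_mult_distrib)

lemma square_integrable_divide: "square_integrable f \<Longrightarrow> square_integrable (\<lambda>x. f x / c)"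
  using square_integrable_cmult[of f "inverse c"] by (simp add: divide_inverse mult.commute)

lemma square_integrable_minus: "square_integrable f \<Longrightarrow> square_integrable (\<lambda>x. - f x)"
  using square_integrable_cmult[of f "-1"] by simp

lemma square_integrable_add:
  assumes f: "square_integrable f" and g: "square_integrable g"
  shows "square_integrable (\<lambda>x. f x + g x)"
  unfolding square_integrable_def
proof
  show "(\<lambda>x. f x + g x) \<in> borel_measurable lborel" using assms by measurable
  have "integrable lborel (\<lambda>x. (f x)\<^sup>2 + (g x)\<^sup>2 + 2 * (f x * g x))"
    using assms square_integrable_mult_integrable[OF assms] by (auto simp: square_integrable_def)
  then show "integrable lborel (\<lambda>x. (f x + g x)\<^sup>2)"
    by (simp add: power2_sum mult.assoc)
qed

lemma square_integrable_diff:
  "square_integrable f \<Longrightarrow> square_integrable g \<Longrightarrow> square_integrable (\<lambda>x. f x - g x)"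
  using square_integrable_add[of f "\<lambda>x. - g x"] square_integrable_minus[of g] by simp

lemma square_integrable_cong_AE:
  assumes "square_integrable f" "AE x in lborel. f x = g x" "g \<in> borel_measurable borel"
  shows "square_integrable g"
  unfolding square_integrable_def
proof
  have [measurable]: "f \<in> borel_measurable borel" using assms(1) by measurable
  note [measurable] = assms(3)
  have "integrable lborel (\<lambda>x. (f x)\<^sup>2) \<longleftrightarrow> integrable lborel (\<lambda>x. (g x)\<^sup>2)"
    using assms(2) by (intro integrable_cong_AE) auto
  then show "integrable lborel (\<lambda>x. (g x)\<^sup>2)" using assms(1) by (simp add: square_integrable_def)
qed (use assms in simp)

lemma square_integrable_mult_bounded:
  assumes f: "square_integrable f" and g: "g \<in> borel_measurable borel"
    and B: "AE x in lborel. \<bar>g x\<bar> \<le> B"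
  shows "square_integrable (\<lambda>x. f x * g x)"
  unfolding square_integrable_def
proof
  note [measurable] = g square_integrable_measurable[OF f]
  show "(\<lambda>x. f x * g x) \<in> borel_measurable lborel" by measurable
  show "integrable lborel (\<lambda>x. (f x * g x)\<^sup>2)"
  proof (rule Bochner_Integration.integrable_bound)
    show "integrable lborel (\<lambda>x. B\<^sup>2 * (f x)\<^sup>2)"
      using f by (simp add: square_integrable_def)
    show "AE x in lborel. norm ((f x * g x)\<^sup>2) \<le> norm (B\<^sup>2 * (f x)\<^sup>2)"
      using B
    proof (rule AE_mp, intro AE_I2 impI)
      fix x assume "\<bar>g x\<bar> \<le> B"
      then have "(g x)\<^sup>2 \<le> B\<^sup>2" by (metis abs_ge_zero power2_abs power_mono)
      then show "norm ((f x * g x)\<^sup>2) \<le> norm (B\<^sup>2 * (f x)\<^sup>2)"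
        by (simp add: power_mult_distrib mult.commute[of _ "(f x)\<^sup>2"] mult_left_mono)
    qed
  qed measurable
qed

lemma square_integrable_locally_integrable:
  assumes f: "square_integrable f"
  shows "locally_integrable f"
  unfolding locally_integrable_def set_integrable_def
proof (intro allI)
  fix a b :: real
  have "square_integrable (indicator {a..b})"
    by (auto simp: square_integrable_def power2_eq_square indicator_inter_arith[symmetric]
        intro!: integrable_real_indicator simp: emeasure_lborel_Icc_eq)
  then show "integrable lborel (\<lambda>x. indicator {a..b} x *\<^sub>R f x)"
    using square_integrable_mult_integrable[OF _ f, of "indicator {a..b}"] by simp
qed

lemma L2_norm_nonneg: "0 \<le> L2_norm f"
  by (simp add: L2_norm_def)

lemma L2_norm_square: "(L2_norm f)\<^sup>2 = (LINT x|lborel. (f x)\<^sup>2)"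
  by (simp add: L2_norm_def)

lemma L2_norm_cong_AE:
  assumes "AE x in lborel. f x = g x" "f \<in> borel_measurable borel" "g \<in> borel_measurable borel"
  shows "L2_norm f = L2_norm g"
proof -
  have "(LINT x|lborel. (f x)\<^sup>2) = (LINT x|lborel. (g x)\<^sup>2)"
    using assms by (intro integral_cong_AE) auto
  then show ?thesis by (simp add: L2_norm_def)
qed

lemma L2_norm_cmult: "L2_norm (\<lambda>x. c * f x) = \<bar>c\<bar> * L2_norm f"
  by (simp add: L2_norm_def power_mult_distrib real_sqrt_mult)

lemma L2_norm_minus: "L2_norm (\<lambda>x. - f x) = L2_norm f"
  by (simp add: L2_norm_def)

lemma L2_norm_add_square:
  assumes f: "square_integrable f" and g: "square_integrable g"
  shows "(L2_norm (\<lambda>x. f x + g x))\<^sup>2 = (L2_norm f)\<^sup>2 + 2 * (LINT x|lborel. f x * g x) + (L2_norm g)\<^sup>2"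
proof -
  have "(LINT x|lborel. (f x + g x)\<^sup>2) = (LINT x|lborel. (f x)\<^sup>2 + 2 * (f x * g x) + (g x)\<^sup>2)"
    by (simp add: power2_sum algebra_simps)
  also have "\<dots> = (L2_norm f)\<^sup>2 + 2 * (LINT x|lborel. f x * g x) + (L2_norm g)\<^sup>2"
    using assms square_integrable_mult_integrable[OF assms]
    by (simp add: L2_norm_square square_integrable_def)
  finally show ?thesis by (simp add: L2_norm_square)
qed

lemma L2_Cauchy_Schwarz:
  assumes f: "square_integrable f" and g: "square_integrable g"
  shows "\<bar>LINT x|lborel. f x * g x\<bar> \<le> L2_norm f * L2_norm g"
proof -
  let ?a = "L2_norm f" and ?b = "L2_norm g"
  define B where "B = (LINT x|lborel. f x * g x)"
  show ?thesis
  proof (cases "?a = 0 \<or> ?b = 0")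
    case True
    then have "AE x in lborel. f x * g x = 0"
    proof
      assume "?a = 0"
      then have "AE x in lborel. (f x)\<^sup>2 = 0"
        using integral_nonneg_eq_0_iff_AE[OF square_integrable_square[OF f]] by (simp add: L2_norm_def)
      then show ?thesis by (rule eventually_mono) simp
    next
      assume "?b = 0"
      then have "AE x in lborel. (g x)\<^sup>2 = 0"
        using integral_nonneg_eq_0_iff_AE[OF square_integrable_square[OF g]] by (simp add: L2_norm_def)
      then show ?thesis by (rule eventually_mono) simp
    qed
    then have "B = 0" unfolding B_def by (rule integral_eq_zero_AE)
    then show ?thesis using L2_norm_nonneg by (simp add: B_def)
  next
    case False
    then have ab: "0 < ?a * ?b" using L2_norm_nonneg[of f] L2_norm_nonneg[of g] by simp
    \<comment> \<open>Here \<open>s\<close> is a sign. The square of the norm of \<open>?b\<close>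
      times \<open>f\<close> minus \<open>s * ?a\<close> times \<open>g\<close> expands to 2 ab (ab
      - sB), writing a, b for \<open>?a\<close>, \<open>?b\<close>; the factor ab is positive in
      this case and can be cancelled.\<close>
    have "s * B \<le> ?a * ?b" if "s\<^sup>2 = 1" for s
    proof -
      have "0 \<le> (L2_norm (\<lambda>x. ?b * f x + (- s * ?a) * g x))\<^sup>2" by simp
      also have "\<dots> = ?b\<^sup>2 * ?a\<^sup>2 + 2 * ((?b * (- s * ?a)) * B) + (s * ?a)\<^sup>2 * ?b\<^sup>2"
      proof -
        have "(\<lambda>x. ?b * f x * (- s * ?a * g x)) = (\<lambda>x. (?b * (- s * ?a)) * (f x * g x))"
          by (simp add: algebra_simps)
        then have "(LINT x|lborel. ?b * f x * (- s * ?a * g x)) = (?b * (- s * ?a)) * B"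
          by (simp add: B_def)
        then show ?thesis
          unfolding L2_norm_add_square[OF square_integrable_cmult[OF f] square_integrable_cmult[OF g]]
          by (simp add: L2_norm_cmult L2_norm_minus power_mult_distrib)
      qed
      also have "\<dots> = 2 * ((?a * ?b) * (?a * ?b - s * B))"
        using that by (simp add: power_mult_distrib algebra_simps power2_eq_square)
      finally show ?thesis using ab by (simp add: zero_le_mult_iff)
    qed
    from this[of 1] this[of "-1"] show ?thesis by (simp add: B_def abs_le_iff)
  qed
qed

lemma L2_norm_triangle:
  assumes f: "square_integrable f" and g: "square_integrable g"
  shows "L2_norm (\<lambda>x. f x + g x) \<le> L2_norm f + L2_norm g"
proof (rule power2_le_imp_le)
  show "(L2_norm (\<lambda>x. f x + g x))\<^sup>2 \<le> (L2_norm f + L2_norm g)\<^sup>2"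
    using L2_Cauchy_Schwarz[OF assms] by (simp add: L2_norm_add_square[OF assms] power2_sum)
qed (simp add: L2_norm_nonneg)

lemma L2_norm_triangle_diff:
  assumes f: "square_integrable f" and g: "square_integrable g"
  shows "L2_norm (\<lambda>x. f x - g x) \<le> L2_norm f + L2_norm g"
  using L2_norm_triangle[OF f square_integrable_minus[OF g]] by (simp add: L2_norm_minus)

subsection \<open>Differentiation with values in \<open>L\<^sup>2\<close>\<close>

text \<open>Square integrability is part of the notion because a divergent integral has the value 0:
  \<open>L2_norm\<close> would then be 0 for functions outside L^2 and the limit would say
  nothing.\<close>

definition has_L2_deriv ::
    "(real \<Rightarrow> real \<Rightarrow> real) \<Rightarrow> (real \<Rightarrow> real) \<Rightarrow> real \<Rightarrow> real set \<Rightarrow> bool" where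
  "has_L2_deriv v v' t S \<longleftrightarrow> (\<forall>s\<in>S. square_integrable (v s)) \<and> t \<in> S \<and> square_integrable v' \<and>
     ((\<lambda>s. L2_norm (\<lambda>x. (v s x - v t x) / (s - t) - v' x)) \<longlongrightarrow> 0) (at t within S)"

lemma has_L2_deriv_diff:
  assumes v: "has_L2_deriv v v' t S" and w: "has_L2_deriv w w' t S"
  shows "has_L2_deriv (\<lambda>s x. v s x - w s x) (\<lambda>x. v' x - w' x) t S"
proof -
  define qv where "qv s x = (v s x - v t x) / (s - t) - v' x" for s x
  define qw where "qw s x = (w s x - w t x) / (s - t) - w' x" for s x
  define q where "q s x = ((v s x - w s x) - (v t x - w t x)) / (s - t) - (v' x - w' x)" for s x
  have S: "square_integrable (qv s)" "square_integrable (qw s)" if "s \<in> S" for s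
    using v w that unfolding has_L2_deriv_def qv_def qw_def
    by (auto intro!: square_integrable_diff square_integrable_divide)
  have "((\<lambda>s. L2_norm (qv s) + L2_norm (qw s)) \<longlongrightarrow> 0 + 0) (at t within S)"
    using v w by (intro tendsto_add) (auto simp: has_L2_deriv_def qv_def[abs_def] qw_def[abs_def])
  then have lim: "((\<lambda>s. L2_norm (qv s) + L2_norm (qw s)) \<longlongrightarrow> 0) (at t within S)" by simp
  have "((\<lambda>s. L2_norm (q s)) \<longlongrightarrow> 0) (at t within S)"
  proof (rule tendsto_sandwich[OF _ _ tendsto_const lim])
    show "eventually (\<lambda>s. 0 \<le> L2_norm (q s)) (at t within S)"
      by (simp add: L2_norm_nonneg)
    have "L2_norm (q s) \<le> L2_norm (qv s) + L2_norm (qw s)" if "s \<in> S" for s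
    proof -
      have "q s = (\<lambda>x. qv s x - qw s x)"
        by (auto simp: q_def qv_def qw_def diff_divide_distrib)
      then show ?thesis using L2_norm_triangle_diff[OF S[OF that]] by simp
    qed
    then show "eventually (\<lambda>s. L2_norm (q s) \<le> L2_norm (qv s) + L2_norm (qw s)) (at t within S)"
      by (auto simp: eventually_at_filter)
  qed
  then show ?thesis
    using v w by (auto simp: has_L2_deriv_def q_def[abs_def] intro: square_integrable_diff)
qed

lemma has_L2_deriv_cong_AE:
  assumes v: "has_L2_deriv v v' t S"
    and eq: "\<And>s. s \<in> S \<Longrightarrow> AE x in lborel. v s x = w s x" "AE x in lborel. v' x = w' x"
    and m: "\<And>s. s \<in> S \<Longrightarrow> w s \<in> borel_measurable borel" "w' \<in> borel_measurable borel"
  shows "has_L2_deriv w w' t S"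
proof -
  have "t \<in> S" using v by (simp add: has_L2_deriv_def)
  have [measurable]: "v s \<in> borel_measurable borel" "v' \<in> borel_measurable borel" if "s \<in> S" for s
    using v that by (auto simp: has_L2_deriv_def square_integrable_measurable)
  note [measurable] = m
  have "L2_norm (\<lambda>x. (v s x - v t x) / (s - t) - v' x) = L2_norm (\<lambda>x. (w s x - w t x) / (s - t) - w' x)"
    if "s \<in> S" for s
  proof (rule L2_norm_cong_AE)
    show "AE x in lborel. (v s x - v t x) / (s - t) - v' x = (w s x - w t x) / (s - t) - w' x"
      using eq(1)[OF that] eq(1)[OF \<open>t \<in> S\<close>] eq(2) by eventually_elim simp
  qed (use that \<open>t \<in> S\<close> in measurable)
  then have "eventually (\<lambda>s. L2_norm (\<lambda>x. (v s x - v t x) / (s - t) - v' x) =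
      L2_norm (\<lambda>x. (w s x - w t x) / (s - t) - w' x)) (at t within S)"
    by (auto simp: eventually_at_filter)
  then have "((\<lambda>s. L2_norm (\<lambda>x. (w s x - w t x) / (s - t) - w' x)) \<longlongrightarrow> 0) (at t within S)"
    using v by (auto simp: has_L2_deriv_def dest: Lim_transform_eventually)
  moreover have "square_integrable (w s)" if "s \<in> S" for s
    using v that by (intro square_integrable_cong_AE[OF _ eq(1)] m) (auto simp: has_L2_deriv_def)
  moreover have "square_integrable w'"
    using v by (intro square_integrable_cong_AE[OF _ eq(2)] m) (auto simp: has_L2_deriv_def)
  ultimately show ?thesis using \<open>t \<in> S\<close> by (simp add: has_L2_deriv_def)
qed

text \<open>Expand the square of v s = v t + (s - t) (v' + r s), where \<open>r s\<close> tends to 0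
  in L^2. Besides the asserted limit, the difference quotient contains a cross term with
  \<open>r s\<close>, small by Cauchy-Schwarz, and a quadratic term with a spare factor s -
  t.\<close>

lemma has_L2_deriv_norm_square:
  assumes v: "has_L2_deriv v v' t S"
  shows "((\<lambda>s. (L2_norm (v s))\<^sup>2) has_real_derivative 2 * (LINT x|lborel. v t x * v' x)) (at t within S)"
proof -
  define r where "r s x = (v s x - v t x) / (s - t) - v' x" for s x
  have vt: "square_integrable (v t)" and v': "square_integrable v'" and "t \<in> S"
    using v by (auto simp: has_L2_deriv_def)
  have r: "square_integrable (r s)" if "s \<in> S" for s
    using v that unfolding has_L2_deriv_def r_def
    by (auto intro!: square_integrable_diff square_integrable_divide)
  have r0: "((\<lambda>s. L2_norm (r s)) \<longlongrightarrow> 0) (at t within S)"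
    using v by (simp add: has_L2_deriv_def r_def[abs_def])
  have eq: "((L2_norm (v s))\<^sup>2 - (L2_norm (v t))\<^sup>2) / (s - t) =
      2 * (LINT x|lborel. v t x * v' x) + 2 * (LINT x|lborel. v t x * r s x) +
      (s - t) * (L2_norm (\<lambda>x. v' x + r s x))\<^sup>2" if "s \<in> S" "s \<noteq> t" for s
  proof -
    have d: "v s = (\<lambda>x. v t x + (s - t) * (v' x + r s x))"
      using \<open>s \<noteq> t\<close> by (auto simp: r_def)
    have vr: "square_integrable (\<lambda>x. v' x + r s x)"
      by (intro square_integrable_add v' r that)
    have "(L2_norm (v s))\<^sup>2 = (L2_norm (v t))\<^sup>2 + 2 * (LINT x|lborel. v t x * ((s - t) * (v' x + r s x)))
        + (L2_norm (\<lambda>x. (s - t) * (v' x + r s x)))\<^sup>2"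
      by (subst d) (rule L2_norm_add_square[OF vt square_integrable_cmult[OF vr]])
    also have "(LINT x|lborel. v t x * ((s - t) * (v' x + r s x))) =
        (LINT x|lborel. (s - t) * (v t x * v' x + v t x * r s x))"
      by (simp add: algebra_simps)
    also have "\<dots> = (s - t) * ((LINT x|lborel. v t x * v' x) + (LINT x|lborel. v t x * r s x))"
      using square_integrable_mult_integrable[OF vt v'] square_integrable_mult_integrable[OF vt r[OF \<open>s \<in> S\<close>]]
      by simp
    finally have "(L2_norm (v s))\<^sup>2 - (L2_norm (v t))\<^sup>2 =
        (s - t) * (2 * (LINT x|lborel. v t x * v' x) + 2 * (LINT x|lborel. v t x * r s x) +
          (s - t) * (L2_norm (\<lambda>x. v' x + r s x))\<^sup>2)"
      unfolding L2_norm_cmult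
      by (simp add: power_mult_distrib distrib_left power2_eq_square[of "s - t"] mult.assoc mult.left_commute)
    then show ?thesis
      using \<open>s \<noteq> t\<close> by simp
  qed
  have "((\<lambda>s. 2 * (LINT x|lborel. v t x * r s x)) \<longlongrightarrow> 0) (at t within S)"
  proof (rule tendsto_rabs_zero_cancel, rule tendsto_sandwich[OF _ _ tendsto_const])
    show "((\<lambda>s. 2 * (L2_norm (v t) * L2_norm (r s))) \<longlongrightarrow> 0) (at t within S)"
      using tendsto_mult_right[OF r0, of "2 * L2_norm (v t)"] by (simp add: mult.assoc mult.left_commute mult.commute)
    have "\<bar>2 * (LINT x|lborel. v t x * r s x)\<bar> \<le> 2 * (L2_norm (v t) * L2_norm (r s))" if "s \<in> S" for s
      using L2_Cauchy_Schwarz[OF vt r[OF that]] by simp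
    then show "eventually (\<lambda>s. \<bar>2 * (LINT x|lborel. v t x * r s x)\<bar> \<le> 2 * (L2_norm (v t) * L2_norm (r s))) (at t within S)"
      by (auto simp: eventually_at_filter)
  qed simp
  moreover have "((\<lambda>s. (s - t) * (L2_norm (\<lambda>x. v' x + r s x))\<^sup>2) \<longlongrightarrow> 0) (at t within S)"
  proof (rule tendsto_rabs_zero_cancel, rule tendsto_sandwich[OF _ _ tendsto_const])
    have "((\<lambda>s. \<bar>s - t\<bar> * (L2_norm v' + L2_norm (r s))\<^sup>2) \<longlongrightarrow> \<bar>t - t\<bar> * (L2_norm v' + 0)\<^sup>2) (at t within S)"
      by (intro tendsto_intros r0)
    then show "((\<lambda>s. \<bar>s - t\<bar> * (L2_norm v' + L2_norm (r s))\<^sup>2) \<longlongrightarrow> 0) (at t within S)" by simp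
    have "\<bar>(s - t) * (L2_norm (\<lambda>x. v' x + r s x))\<^sup>2\<bar> \<le> \<bar>s - t\<bar> * (L2_norm v' + L2_norm (r s))\<^sup>2"
      if "s \<in> S" for s
      unfolding abs_mult
      using L2_norm_triangle[OF v' r[OF that]] L2_norm_nonneg by (intro mult_left_mono) (auto intro!: power_mono)
    then show "eventually (\<lambda>s. \<bar>(s - t) * (L2_norm (\<lambda>x. v' x + r s x))\<^sup>2\<bar> \<le> \<bar>s - t\<bar> * (L2_norm v' + L2_norm (r s))\<^sup>2) (at t within S)"
      by (auto simp: eventually_at_filter)
  qed simp
  ultimately have "((\<lambda>s. 2 * (LINT x|lborel. v t x * v' x) + 2 * (LINT x|lborel. v t x * r s x) +
      (s - t) * (L2_norm (\<lambda>x. v' x + r s x))\<^sup>2) \<longlongrightarrow> 2 * (LINT x|lborel. v t x * v' x) + 0 + 0) (at t within S)"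
    by (intro tendsto_add tendsto_const)
  moreover have "eventually (\<lambda>s. 2 * (LINT x|lborel. v t x * v' x) + 2 * (LINT x|lborel. v t x * r s x) +
      (s - t) * (L2_norm (\<lambda>x. v' x + r s x))\<^sup>2 = ((L2_norm (v s))\<^sup>2 - (L2_norm (v t))\<^sup>2) / (s - t)) (at t within S)"
    using eq by (auto simp: eventually_at_filter)
  ultimately show ?thesis
    unfolding has_field_derivative_iff by (auto dest: Lim_transform_eventually)
qed

subsection \<open>Functions with one weak derivative in \<open>L\<^sup>2\<close>\<close>

text \<open>The derivative is an argument rather than the choice \<open>weak_deriv 1 f\<close>, so
  that differences and products come with an explicit derivative instead of one known up to a null
  set.\<close>

definition H1 :: "(real \<Rightarrow> real) \<Rightarrow> (real \<Rightarrow> real) \<Rightarrow> bool" where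
  "H1 f f' \<longleftrightarrow> has_weak_deriv 1 f f' \<and> square_integrable f \<and> square_integrable f'"

lemma H1_primitive:
  assumes "H1 f f'"
  obtains F where "primitive F f'" "AE x in lborel. f x = F x" "square_integrable F" "square_integrable f'"
proof -
  have "has_weak_deriv 1 f f'" using assms by (simp add: H1_def)
  then obtain F where F: "primitive F f'" "AE x in lborel. f x = F x"
    by (rule has_weak_deriv_primitive)
  moreover have "square_integrable F"
    using assms F primitive_measurable by (auto simp: H1_def intro: square_integrable_cong_AE)
  ultimately show ?thesis using that assms by (auto simp: H1_def)
qed

lemma H1_diff: "H1 f f' \<Longrightarrow> H1 g g' \<Longrightarrow> H1 (\<lambda>x. f x - g x) (\<lambda>x. f' x - g' x)"
  by (simp add: H1_def has_weak_deriv_diff square_integrable_diff)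

text \<open>The square of the continuous representative \<open>F\<close> is a primitive of 2 F f',
  and its absolute value is at most F^2 + f'^2.\<close>

lemma H1_sup_bound:
  assumes "H1 f f'"
  shows "AE x in lborel. \<bar>f x\<bar> \<le> sqrt ((L2_norm f)\<^sup>2 + (L2_norm f')\<^sup>2)"
proof -
  obtain F where F: "primitive F f'" "AE x in lborel. f x = F x" "square_integrable F" "square_integrable f'"
    using H1_primitive[OF assms] .
  have i: "integrable lborel (\<lambda>x. f' x * F x)" "integrable lborel (\<lambda>x. F x * f' x)"
    using F by (auto intro: square_integrable_mult_integrable)
  have "(F x)\<^sup>2 \<le> (L2_norm F)\<^sup>2 + (L2_norm f')\<^sup>2" for x
  proof -
    have "\<bar>F x * F x\<bar> \<le> (LINT x|lborel. \<bar>f' x * F x + F x * f' x\<bar>)"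
      using F i by (intro primitive_sup_bound[OF primitive_mult]) (auto intro: square_integrable_mult_integrable)
    also have "\<dots> \<le> (LINT x|lborel. (F x)\<^sup>2 + (f' x)\<^sup>2)"
    proof (rule integral_mono)
      fix x
      show "\<bar>f' x * F x + F x * f' x\<bar> \<le> (F x)\<^sup>2 + (f' x)\<^sup>2"
        using sum_squares_bound[of "\<bar>F x\<bar>" "\<bar>f' x\<bar>"] by (simp add: abs_mult mult.commute mult.left_commute)
    qed (use F i in \<open>auto simp: square_integrable_def\<close>)
    also have "\<dots> = (L2_norm F)\<^sup>2 + (L2_norm f')\<^sup>2"
      using F by (simp add: L2_norm_square square_integrable_def)
    finally show ?thesis by (simp add: power2_eq_square)
  qed
  then have F': "\<bar>F x\<bar> \<le> sqrt ((L2_norm F)\<^sup>2 + (L2_norm f')\<^sup>2)" for x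
    by (simp add: real_le_rsqrt)
  moreover have "L2_norm F = L2_norm f"
    using F assms by (intro L2_norm_cong_AE) (auto simp: H1_def square_integrable_def elim: eventually_mono)
  ultimately show ?thesis using F(2) by (auto elim!: eventually_mono)
qed

text \<open>The product of the continuous representatives is integrable with integrable derivative,
  so that derivative has integral 0; afterwards the representatives are exchanged for
  \<open>f\<close> and \<open>g\<close> under the integrals.\<close>

lemma H1_integration_by_parts:
  assumes "H1 f f'" "H1 g g'"
  shows "(LINT x|lborel. f x * g' x) = - (LINT x|lborel. f' x * g x)"
proof -
  obtain F where F: "primitive F f'" "AE x in lborel. f x = F x" "square_integrable F" "square_integrable f'"
    using H1_primitive[OF assms(1)] .
  obtain G where G: "primitive G g'" "AE x in lborel. g x = G x" "square_integrable G" "square_integrable g'"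
    using H1_primitive[OF assms(2)] .
  note [measurable] = F(3,4) G(3,4)
  have [measurable]: "f \<in> borel_measurable borel" "g \<in> borel_measurable borel"
    using assms by (auto simp: H1_def square_integrable_def)
  have i: "integrable lborel (\<lambda>x. f' x * G x)" "integrable lborel (\<lambda>x. F x * g' x)"
    "integrable lborel (\<lambda>x. F x * G x)"
    using F G by (auto intro: square_integrable_mult_integrable)
  then have "(LINT x|lborel. f' x * G x + F x * g' x) = 0"
    by (intro primitive_integral_eq_0[OF primitive_mult[OF F(1) G(1)]]) auto
  with i have "(LINT x|lborel. F x * g' x) = - (LINT x|lborel. f' x * G x)" by simp
  moreover have "(LINT x|lborel. F x * g' x) = (LINT x|lborel. f x * g' x)"
    using F(2) by (intro integral_cong_AE) auto
  moreover have "(LINT x|lborel. f' x * G x) = (LINT x|lborel. f' x * g x)"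
    using G(2) by (intro integral_cong_AE) auto
  ultimately show ?thesis by simp
qed

text \<open>The algebra property of H^1 on the line: each term of the Leibniz formula is an L^2
  function times an essentially bounded one, by \<open>H1_sup_bound\<close>.\<close>

lemma H1_mult:
  assumes "H1 f f'" "H1 g g'"
  shows "H1 (\<lambda>x. f x * g x) (\<lambda>x. f' x * g x + f x * g' x)"
proof -
  obtain F where F: "primitive F f'" "AE x in lborel. f x = F x" "square_integrable F" "square_integrable f'"
    using H1_primitive[OF assms(1)] .
  obtain G where G: "primitive G g'" "AE x in lborel. g x = G x" "square_integrable G" "square_integrable g'"
    using H1_primitive[OF assms(2)] .
  have sq: "square_integrable f" "square_integrable g" using assms by (auto simp: H1_def)
  note [measurable] = sq F(4) G(4)
  have "has_weak_deriv 1 (\<lambda>x. F x * G x) (\<lambda>x. f' x * G x + F x * g' x)"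
    by (rule primitive_has_weak_deriv[OF primitive_mult[OF F(1) G(1)]])
  then have "has_weak_deriv 1 (\<lambda>x. f x * g x) (\<lambda>x. f' x * g x + f x * g' x)"
  proof (rule has_weak_deriv_cong_AE)
    show "AE x in lborel. F x * G x = f x * g x" using F(2) G(2) by eventually_elim simp
    show "AE x in lborel. f' x * G x + F x * g' x = f' x * g x + f x * g' x"
      using F(2) G(2) by eventually_elim simp
  qed measurable
  moreover have "square_integrable (\<lambda>x. f x * g x)"
    using sq H1_sup_bound[OF assms(2)] by (intro square_integrable_mult_bounded) auto
  moreover have "square_integrable (\<lambda>x. f' x * g x)"
    using F(4) sq H1_sup_bound[OF assms(2)] by (intro square_integrable_mult_bounded) auto
  moreover have "square_integrable (\<lambda>x. g' x * f x)"
    using G(4) sq H1_sup_bound[OF assms(1)] by (intro square_integrable_mult_bounded) auto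
  ultimately show ?thesis
    unfolding H1_def by (auto intro: square_integrable_add simp: mult.commute)
qed

subsection \<open>Sobolev spaces\<close>

text \<open>\<open>sobolev\<close> only asserts that some weak derivative is square integrable. The
  chosen one inherits this because the two agree a.e. and local integrability makes it
  measurable.\<close>

lemma sobolev_weak_deriv:
  assumes "sobolev k f" "j \<le> k"
  shows "has_weak_deriv j f (weak_deriv j f)" "square_integrable (weak_deriv j f)"
proof -
  obtain g where g: "has_weak_deriv j f g" "square_integrable g"
    using assms by (auto simp: sobolev_def)
  show *: "has_weak_deriv j f (weak_deriv j f)" by (rule has_weak_deriv_weak_deriv[OF g(1)])
  then have "weak_deriv j f \<in> borel_measurable borel"
    using locally_integrable_measurable by (auto simp: has_weak_deriv_def)
  then show "square_integrable (weak_deriv j f)"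
    using weak_deriv_AE_eq[OF g(1)] g(2) by (auto intro: square_integrable_cong_AE)
qed

lemma sobolev_square_integrable: "sobolev k f \<Longrightarrow> square_integrable f"
  by (simp add: sobolev_def)

lemma weak_deriv_0_AE: "square_integrable f \<Longrightarrow> AE x in lborel. weak_deriv 0 f x = f x"
  by (intro weak_deriv_AE_eq has_weak_deriv_0 square_integrable_locally_integrable)

lemma sobolev_H1: "sobolev k f \<Longrightarrow> 1 \<le> k \<Longrightarrow> H1 f (weak_deriv 1 f)"
  by (simp add: H1_def sobolev_weak_deriv sobolev_square_integrable)

lemma sobolev_H1': "sobolev k f \<Longrightarrow> 2 \<le> k \<Longrightarrow> H1 (weak_deriv 1 f) (weak_deriv 2 f)"
  using sobolev_weak_deriv[of k f 1] sobolev_weak_deriv[of k f 2]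
    has_weak_deriv_deriv[of f "weak_deriv 1 f" "weak_deriv 2 f"]
  by (simp add: H1_def)

lemma sobolev_norm_nonneg: "0 \<le> sobolev_norm k f"
  by (simp add: sobolev_norm_def sum_nonneg)

lemma sobolev_norm_ge:
  assumes "J \<subseteq> {..k}"
  shows "sqrt (\<Sum>j\<in>J. (L2_norm (weak_deriv j f))\<^sup>2) \<le> sobolev_norm k f"
  unfolding sobolev_norm_def using assms by (intro real_sqrt_le_mono sum_mono2) auto

lemma L2_norm_weak_deriv_le: "j \<le> k \<Longrightarrow> L2_norm (weak_deriv j f) \<le> sobolev_norm k f"
  using sobolev_norm_ge[of "{j}" k f] by (simp add: L2_norm_nonneg)

lemma sobolev_sup_bound:
  assumes f: "sobolev k f" and k: "1 \<le> k"
  shows "AE x in lborel. \<bar>f x\<bar> \<le> sobolev_norm k f"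
proof -
  have "L2_norm (weak_deriv 0 f) = L2_norm f"
    using sobolev_weak_deriv(2)[OF f, of 0] sobolev_square_integrable[OF f]
    by (intro L2_norm_cong_AE weak_deriv_0_AE) auto
  then have "sqrt ((L2_norm f)\<^sup>2 + (L2_norm (weak_deriv 1 f))\<^sup>2) \<le> sobolev_norm k f"
    using sobolev_norm_ge[of "{0,1}" k f] k by simp
  then show ?thesis
    using H1_sup_bound[OF sobolev_H1[OF f k]] by (auto elim!: eventually_mono)
qed

lemma sobolev_deriv_sup_bound:
  assumes f: "sobolev k f" and k: "2 \<le> k"
  shows "AE x in lborel. \<bar>weak_deriv 1 f x\<bar> \<le> sobolev_norm k f"
proof -
  have "sqrt ((L2_norm (weak_deriv 1 f))\<^sup>2 + (L2_norm (weak_deriv 2 f))\<^sup>2) \<le> sobolev_norm k f"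
    using sobolev_norm_ge[of "{1,2}" k f] k by simp
  then show ?thesis
    using H1_sup_bound[OF sobolev_H1'[OF f k]] by (auto elim!: eventually_mono)
qed

text \<open>The error in the difference quotient of the weak derivatives is a.e. the weak derivative
  of the error for \<open>v\<close>, and its norm is one summand of the Sobolev norm of the
  latter.\<close>

lemma C1_sobolev_has_L2_deriv:
  assumes v: "C1_sobolev k T v v'" and j: "j \<le> k" and t: "t \<in> {0..T}"
  shows "has_L2_deriv (\<lambda>s. weak_deriv j (v s)) (weak_deriv j (v' t)) t {0..T}"
proof -
  have S: "sobolev k (v s)" "sobolev k (v' s)" if "s \<in> {0..T}" for s
    using v that by (auto simp: C1_sobolev_def)
  note wd = sobolev_weak_deriv[OF S(1) j] sobolev_weak_deriv[OF S(2) j]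
  have "((\<lambda>s. L2_norm (\<lambda>x. (weak_deriv j (v s) x - weak_deriv j (v t) x) / (s - t) - weak_deriv j (v' t) x))
      \<longlongrightarrow> 0) (at t within {0..T})"
  proof (rule tendsto_sandwich[OF _ _ tendsto_const])
    show "((\<lambda>s. sobolev_norm k (\<lambda>x. (v s x - v t x) / (s - t) - v' t x)) \<longlongrightarrow> 0) (at t within {0..T})"
      using v t by (simp add: C1_sobolev_def)
    have "L2_norm (\<lambda>x. (weak_deriv j (v s) x - weak_deriv j (v t) x) / (s - t) - weak_deriv j (v' t) x)
        \<le> sobolev_norm k (\<lambda>x. (v s x - v t x) / (s - t) - v' t x)" (is "L2_norm ?q \<le> sobolev_norm k ?d")
      if s: "s \<in> {0..T}" for s
    proof -
      \<comment> \<open>With \<open>inverse 0 = 0\<close> this also covers \<open>s = t\<close>, so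
        that case needs no separate treatment.\<close>
      have "has_weak_deriv j (\<lambda>x. inverse (s - t) * (v s x - v t x) - v' t x)
          (\<lambda>x. inverse (s - t) * (weak_deriv j (v s) x - weak_deriv j (v t) x) - weak_deriv j (v' t) x)"
        by (intro has_weak_deriv_diff has_weak_deriv_cmult wd s t)
      then have d: "has_weak_deriv j ?d ?q" by (simp add: divide_inverse mult.commute)
      have "L2_norm ?q = L2_norm (weak_deriv j ?d)"
      proof (rule L2_norm_cong_AE)
        show "AE x in lborel. ?q x = weak_deriv j ?d x"
          using weak_deriv_AE_eq[OF d] by (auto elim: eventually_mono)
        show "?q \<in> borel_measurable borel" "weak_deriv j ?d \<in> borel_measurable borel"
          using d has_weak_deriv_weak_deriv[OF d] locally_integrable_measurable
          by (auto simp: has_weak_deriv_def)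
      qed
      then show ?thesis using L2_norm_weak_deriv_le[OF j, of ?d] by simp
    qed
    then show "eventually (\<lambda>s. L2_norm (\<lambda>x. (weak_deriv j (v s) x - weak_deriv j (v t) x) / (s - t) - weak_deriv j (v' t) x)
        \<le> sobolev_norm k (\<lambda>x. (v s x - v t x) / (s - t) - v' t x)) (at t within {0..T})"
      by (auto simp: eventually_at_filter)
  qed (simp add: L2_norm_nonneg)
  then show ?thesis using t wd by (simp add: has_L2_deriv_def)
qed

text \<open>Even \<open>weak_deriv 0\<close> is a choice and returns the function only up to a null
  set, hence the transfer between representatives.\<close>

lemma C1_sobolev_has_L2_deriv_0:
  assumes v: "C1_sobolev k T v v'" and t: "t \<in> {0..T}"
  shows "has_L2_deriv v (v' t) t {0..T}"
proof (rule has_L2_deriv_cong_AE[OF C1_sobolev_has_L2_deriv[OF v le0 t]])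
  have S: "square_integrable (v s)" "square_integrable (v' s)" if "s \<in> {0..T}" for s
    using v that by (auto simp: C1_sobolev_def sobolev_def)
  show "AE x in lborel. weak_deriv 0 (v s) x = v s x" if "s \<in> {0..T}" for s
    by (rule weak_deriv_0_AE[OF S(1)[OF that]])
  show "AE x in lborel. weak_deriv 0 (v' t) x = v' t x"
    by (rule weak_deriv_0_AE[OF S(2)[OF t]])
  show "v s \<in> borel_measurable borel" if "s \<in> {0..T}" for s
    using S(1)[OF that] by measurable
  show "v' t \<in> borel_measurable borel" using S(2)[OF t] by measurable
qed

subsection \<open>The energy estimate\<close>

text \<open>For y = sqrt (E + \<mu>) the hypothesis becomes the linear inequality y' \<le> A y + B,
  because E \<le> y^2 and sqrt E \<le> y; an integrating factor then finishes.\<close>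

lemma Gronwall_sqrt:
  fixes E E' :: "real \<Rightarrow> real"
  assumes d: "\<And>s. s \<in> {0..T} \<Longrightarrow> (E has_real_derivative E' s) (at s within {0..T})"
    and le: "\<And>s. s \<in> {0..T} \<Longrightarrow> E' s \<le> 2 * A * E s + 2 * B * sqrt (E s)"
    and E: "\<And>s. s \<in> {0..T} \<Longrightarrow> 0 \<le> E s" "E 0 = 0"
    and AB: "0 \<le> A" "0 \<le> B" and t: "t \<in> {0..T}"
  shows "sqrt (E t) \<le> B * t * exp (A * t)"
proof (rule field_le_epsilon)
  fix e :: real assume "e > 0"
  \<comment> \<open>\<open>sqrt\<close> is not differentiable at \<open>0\<close>, hence the shift of \<open>E\<close> by \<open>\<mu> > 0\<close>.\<close>
  define \<mu> where "\<mu> = (e / exp (A * t))\<^sup>2"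
  have "\<mu> > 0" using \<open>e > 0\<close> by (simp add: \<mu>_def)
  define y where "y s = sqrt (E s + \<mu>)" for s
  \<comment> \<open>The damped forcing exp (-A s) B is bounded by B, so subtracting
    \<open>B * s\<close> already makes \<open>z\<close> nonincreasing and keeps the bound linear in
    time.\<close>
  define z where "z s = exp (- (A * s)) * y s - B * s" for s
  define z' where "z' s = exp (- (A * s)) * (- A) * y s + E' s / (2 * y s) * exp (- (A * s)) - B" for s
  have y: "y s > 0" "(y s)\<^sup>2 = E s + \<mu>" "sqrt (E s) \<le> y s" if "s \<in> {0..T}" for s
    using E(1)[OF that] \<open>\<mu> > 0\<close> by (simp_all add: y_def)
  have dz: "(z has_real_derivative z' s) (at s within {0..T})" if s: "s \<in> {0..T}" for s
  proof -
    have "((\<lambda>s. E s + \<mu>) has_real_derivative E' s) (at s within {0..T})"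
      using d[OF s] by (auto intro!: derivative_eq_intros)
    moreover have "(sqrt has_real_derivative inverse (sqrt (E s + \<mu>)) / 2) (at (E s + \<mu>))"
      using E(1)[OF s] \<open>\<mu> > 0\<close> by (intro DERIV_real_sqrt) auto
    ultimately have "(y has_real_derivative inverse (sqrt (E s + \<mu>)) / 2 * E' s) (at s within {0..T})"
      unfolding y_def by (rule DERIV_chain2[rotated])
    then have "(y has_real_derivative E' s / (2 * y s)) (at s within {0..T})"
      by (simp add: y_def field_simps)
    then show ?thesis
      unfolding z_def z'_def by (auto intro!: derivative_eq_intros)
  qed
  have z'_le: "z' s \<le> 0" if s: "s \<in> {0..T}" for s
  proof -
    have "E' s \<le> 2 * A * (y s)\<^sup>2 + 2 * B * y s"
      using le[OF s] mult_left_mono[OF y(3)[OF s], of "2 * B"] AB \<open>\<mu> > 0\<close>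
        mult_left_mono[of "E s" "(y s)\<^sup>2" "2 * A"] y(2)[OF s] by simp
    also have "\<dots> = (A * y s + B) * (2 * y s)" by (simp add: algebra_simps power2_eq_square)
    finally have "E' s / (2 * y s) \<le> A * y s + B"
      using y(1)[OF s] by (simp add: pos_divide_le_eq)
    then have "z' s \<le> exp (- (A * s)) * (- A) * y s + (A * y s + B) * exp (- (A * s)) - B"
      unfolding z'_def using mult_right_mono[of "E' s / (2 * y s)" "A * y s + B" "exp (- (A * s))"] by simp
    also have "\<dots> = B * (exp (- (A * s)) - 1)" by (simp add: algebra_simps)
    also have "\<dots> \<le> 0" using AB s by (intro mult_nonneg_nonpos) auto
    finally show ?thesis .
  qed
  \<comment> \<open>At the ends of \<open>{0..T}\<close> the derivatives are one-sided; continuity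
    on the closed interval and derivatives at interior points suffice for monotonicity.\<close>
  have "z t \<le> z 0"
  proof (rule DERIV_nonpos_imp_decreasing_open[where f = z and a = 0 and b = t])
    show "0 \<le> t" using t by simp
    show "continuous_on {0..t} z"
      by (rule continuous_on_subset[OF DERIV_continuous_on[OF dz]]) (use t in auto)
    fix x assume "0 < x" "x < t"
    then have x: "x \<in> {0..T}" "0 < x" "x < T" using t by auto
    then have "(z has_real_derivative z' x) (at x)"
      using dz[OF x(1)] by (simp add: at_within_Icc_at)
    with z'_le[OF x(1)] show "\<exists>y. (z has_real_derivative y) (at x) \<and> y \<le> 0" by blast
  qed
  then have "exp (- (A * t)) * y t \<le> sqrt \<mu> + B * t" by (simp add: z_def y_def E(2))
  then have "exp (A * t) * (exp (- (A * t)) * y t) \<le> exp (A * t) * (sqrt \<mu> + B * t)"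
    by (rule mult_left_mono) simp
  then have "y t \<le> exp (A * t) * (sqrt \<mu> + B * t)"
    by (simp add: mult.assoc[symmetric] exp_minus_inverse)
  \<comment> \<open>\<open>\<mu>\<close> was chosen so that the artificial initial value, amplified
    by \<open>exp (A * t)\<close>, contributes exactly \<open>e\<close>.\<close>
  also have "sqrt \<mu> = e / exp (A * t)" using \<open>e > 0\<close> by (simp add: \<mu>_def)
  also have "exp (A * t) * (e / exp (A * t) + B * t) = B * t * exp (A * t) + e"
    by (simp add: field_simps)
  finally show "sqrt (E t) \<le> B * t * exp (A * t) + e" using y(3)[OF t] by linarith
qed

text \<open>Here \<open>u\<close>, \<open>z\<close>, \<open>v\<close> stand for \<open>u\<epsilon>\<close>, \<open>\<eta>0\<close>, \<open>u0\<close> at a fixed time, and suffixes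
  \<open>t\<close>, \<open>x\<close> denote derivatives.\<close>

lemma energy_estimate:
  assumes h: "H1 h hx" and w: "H1 w wx" and wt: "H1 wtx wtxx"
    and u: "H1 u ux" and z: "H1 z zx" and v: "H1 v vx"
    and sq: "square_integrable ht" "square_integrable wt" "square_integrable uxx"
    and bounds: "AE x in lborel. \<bar>z x\<bar> \<le> K" "AE x in lborel. \<bar>zx x\<bar> \<le> K"
      "AE x in lborel. \<bar>u x\<bar> \<le> K" "AE x in lborel. \<bar>ux x\<bar> \<le> K"
      "AE x in lborel. \<bar>vx x\<bar> \<le> K" "L2_norm uxx \<le> K"
    and ht: "AE x in lborel. ht x = - (wx x + (zx x * w x + z x * wx x) + (hx x * u x + h x * ux x))"
    and wt_eq: "AE x in lborel.
      wt x - \<delta> * wtxx x = - (hx x + u x * wx x + w x * vx x) + \<epsilon> * uxx x"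
    and \<epsilon>: "0 \<le> \<epsilon>"
  shows "2 * (LINT x|lborel. h x * ht x) + 2 * (LINT x|lborel. w x * wt x)
      + \<delta> * (2 * (LINT x|lborel. wx x * wtx x))
    \<le> 4 * K * ((L2_norm h)\<^sup>2 + (L2_norm w)\<^sup>2 + (L2_norm wx)\<^sup>2) + 2 * \<epsilon> * K * L2_norm w"
proof -
  have S: "square_integrable h" "square_integrable hx" "square_integrable w" "square_integrable wx"
    "square_integrable wtx" "square_integrable wtxx" "square_integrable u" "square_integrable ux"
    "square_integrable z" "square_integrable zx" "square_integrable v" "square_integrable vx"
    using h w wt u z v by (auto simp: H1_def)
  note [measurable] = S sq
  have hu: "H1 (\<lambda>x. h x * u x) (\<lambda>x. hx x * u x + h x * ux x)" by (rule H1_mult[OF h u])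
  have zw: "square_integrable (\<lambda>x. zx x * w x + z x * wx x)"
    using H1_mult[OF z w] by (simp add: H1_def)
  have uwx: "square_integrable (\<lambda>x. wx x * u x)"
    using S bounds by (intro square_integrable_mult_bounded) auto
  have vxw: "square_integrable (\<lambda>x. w x * vx x)"
    using S bounds by (intro square_integrable_mult_bounded) auto
  have hux: "square_integrable (\<lambda>x. h x * ux x)"
    using S bounds by (intro square_integrable_mult_bounded) auto
  have hu_x: "square_integrable (\<lambda>x. hx x * u x + h x * ux x)" and huS: "square_integrable (\<lambda>x. h x * u x)"
    using hu by (simp_all add: H1_def)
  note I = square_integrable_mult_integrable
  \<comment> \<open>What remains after all cancellations, apart from the forcing: quadratic in
    \<open>h\<close>, \<open>w\<close>, \<open>wx\<close>, with coefficients bounded by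
    \<open>K\<close> and no occurrence of \<open>hx\<close>.\<close>
  define Q where "Q x = - (2 * (h x * (zx x * w x + z x * wx x))) - h x * (h x * ux x)
      - 2 * (w x * (wx x * u x)) - 2 * (w x * (w x * vx x))" for x
  have Qi: "integrable lborel Q"
    unfolding Q_def using I S zw uwx vxw hux by auto
  \<comment> \<open>Makes the two linear coupling terms, h w_x from the first equation and w h_x
    from the second, cancel in the sum.\<close>
  have 1: "(LINT x|lborel. w x * hx x) = - (LINT x|lborel. wx x * h x)"
    by (rule H1_integration_by_parts[OF w h])
  \<comment> \<open>Moving the derivative of the product onto \<open>h\<close> reproduces the
    dangerous integral with the opposite sign; only the part with \<open>ux\<close> is left, once
    instead of twice.\<close>
  have 2: "2 * (LINT x|lborel. h x * (hx x * u x + h x * ux x)) = (LINT x|lborel. h x * (h x * ux x))"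
  proof -
    have "(LINT x|lborel. h x * (hx x * u x + h x * ux x)) = - (LINT x|lborel. hx x * (h x * u x))"
      by (rule H1_integration_by_parts[OF h hu])
    moreover have "(LINT x|lborel. h x * (h x * ux x)) =
        (LINT x|lborel. h x * (hx x * u x + h x * ux x) - hx x * (h x * u x))"
      by (simp add: algebra_simps)
    moreover have "\<dots> = (LINT x|lborel. h x * (hx x * u x + h x * ux x)) - (LINT x|lborel. hx x * (h x * u x))"
      by (intro Bochner_Integration.integral_diff I S hu_x huS)
    ultimately show ?thesis by simp
  qed
  \<comment> \<open>Turns the dispersive term into the time derivative of the part of the energy
    that carries the weight \<open>\<delta>\<close>.\<close>
  have 3: "(LINT x|lborel. w x * wtxx x) = - (LINT x|lborel. wx x * wtx x)"
    by (rule H1_integration_by_parts[OF w wt])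
  have A: "(LINT x|lborel. h x * ht x) =
      - (LINT x|lborel. wx x * h x) - (LINT x|lborel. h x * (zx x * w x + z x * wx x))
      - (LINT x|lborel. h x * (hx x * u x + h x * ux x))"
  proof -
    have "(LINT x|lborel. h x * ht x) = (LINT x|lborel. - (wx x * h x) -
        h x * (zx x * w x + z x * wx x) - h x * (hx x * u x + h x * ux x))"
    proof (rule integral_cong_AE)
      show "AE x in lborel. h x * ht x = - (wx x * h x) -
        h x * (zx x * w x + z x * wx x) - h x * (hx x * u x + h x * ux x)"
        using ht by eventually_elim algebra
    qed measurable
    then show ?thesis using I S zw hu_x by simp
  qed
  have B: "(LINT x|lborel. w x * wt x) - \<delta> * (LINT x|lborel. w x * wtxx x) =
      - (LINT x|lborel. w x * hx x) - (LINT x|lborel. w x * (wx x * u x)) - (LINT x|lborel. w x * (w x * vx x))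
      + \<epsilon> * (LINT x|lborel. w x * uxx x)"
  proof -
    have "(LINT x|lborel. w x * wt x) - \<delta> * (LINT x|lborel. w x * wtxx x) =
        (LINT x|lborel. w x * wt x - \<delta> * (w x * wtxx x))"
      using I S sq by simp
    also have "\<dots> = (LINT x|lborel. - (w x * hx x) - w x * (wx x * u x) - w x * (w x * vx x) + \<epsilon> * (w x * uxx x))"
    proof (rule integral_cong_AE)
      show "AE x in lborel. w x * wt x - \<delta> * (w x * wtxx x) =
        - (w x * hx x) - w x * (wx x * u x) - w x * (w x * vx x) + \<epsilon> * (w x * uxx x)"
        using wt_eq
      proof eventually_elim
        case (elim x)
        have "w x * wt x - \<delta> * (w x * wtxx x) = w x * (wt x - \<delta> * wtxx x)" by (simp add: algebra_simps)
        then show ?case unfolding elim by (simp add: algebra_simps)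
      qed
    qed measurable
    also have "\<dots> = - (LINT x|lborel. w x * hx x) - (LINT x|lborel. w x * (wx x * u x))
        - (LINT x|lborel. w x * (w x * vx x)) + \<epsilon> * (LINT x|lborel. w x * uxx x)"
      using I S uwx vxw sq by simp
    finally show ?thesis .
  qed
  have C: "(LINT x|lborel. Q x) = - (2 * (LINT x|lborel. h x * (zx x * w x + z x * wx x))) -
      (LINT x|lborel. h x * (h x * ux x)) - 2 * (LINT x|lborel. w x * (wx x * u x)) - 2 * (LINT x|lborel. w x * (w x * vx x))"
    unfolding Q_def using I S zw uwx vxw hux by simp
  have "2 * (LINT x|lborel. h x * ht x) + 2 * (LINT x|lborel. w x * wt x)
      + \<delta> * (2 * (LINT x|lborel. wx x * wtx x)) =
    (LINT x|lborel. Q x) + 2 * \<epsilon> * (LINT x|lborel. w x * uxx x)"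
    using 1 2 3 A B C by (simp add: algebra_simps)
  moreover have "(LINT x|lborel. Q x) \<le> 4 * K * ((L2_norm h)\<^sup>2 + (L2_norm w)\<^sup>2 + (L2_norm wx)\<^sup>2)"
  proof -
    have "(LINT x|lborel. Q x) \<le> (LINT x|lborel. 4 * K * ((h x)\<^sup>2 + (w x)\<^sup>2 + (wx x)\<^sup>2))"
    proof (rule integral_mono_AE[OF Qi])
      show "AE x in lborel. Q x \<le> 4 * K * ((h x)\<^sup>2 + (w x)\<^sup>2 + (wx x)\<^sup>2)"
        using bounds(1-5)
      proof eventually_elim
        case (elim x)
        then have K: "K \<ge> 0" by linarith
        have m: "2 * (a * (b * c)) \<le> K * (a\<^sup>2 + b\<^sup>2)" "- (2 * (a * (b * c))) \<le> K * (a\<^sup>2 + b\<^sup>2)"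
          if "\<bar>c\<bar> \<le> K" for a b c :: real
        proof -
          have "\<bar>2 * (a * (b * c))\<bar> = \<bar>c\<bar> * (2 * \<bar>a\<bar> * \<bar>b\<bar>)" by (simp add: abs_mult)
          also have "\<dots> \<le> K * (a\<^sup>2 + b\<^sup>2)"
            using that sum_squares_bound[of "\<bar>a\<bar>" "\<bar>b\<bar>"] K by (intro mult_mono) auto
          finally show "2 * (a * (b * c)) \<le> K * (a\<^sup>2 + b\<^sup>2)" "- (2 * (a * (b * c))) \<le> K * (a\<^sup>2 + b\<^sup>2)"
            by (auto simp: abs_le_iff)
        qed
        have "Q x = - (2 * (h x * (w x * zx x))) - 2 * (h x * (wx x * z x)) - (2 * (h x * (h x * ux x))) / 2
            - 2 * (w x * (wx x * u x)) - 2 * (w x * (w x * vx x))"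
          by (simp add: Q_def algebra_simps)
        also have "\<dots> \<le> K * ((h x)\<^sup>2 + (w x)\<^sup>2) + K * ((h x)\<^sup>2 + (wx x)\<^sup>2) + K * ((h x)\<^sup>2 + (h x)\<^sup>2) / 2
            + K * ((w x)\<^sup>2 + (wx x)\<^sup>2) + K * ((w x)\<^sup>2 + (w x)\<^sup>2)"
          using m(2)[of "zx x" "h x" "w x"] m(2)[of "z x" "h x" "wx x"] m(2)[of "ux x" "h x" "h x"]
            m(2)[of "u x" "w x" "wx x"] m(2)[of "vx x" "w x" "w x"] elim by linarith
        \<comment> \<open>The squares of \<open>h\<close>, \<open>w\<close> and \<open>wx\<close>
          have been collected 3, 4 and 2 times; the largest count gives the factor 4.\<close>
        also have "\<dots> \<le> 4 * K * ((h x)\<^sup>2 + (w x)\<^sup>2 + (wx x)\<^sup>2)"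
          using mult_nonneg_nonneg[OF K, of "(h x)\<^sup>2"] mult_nonneg_nonneg[OF K, of "(wx x)\<^sup>2"]
          by (simp add: algebra_simps)
        finally show ?case .
      qed
    qed (use S in \<open>auto simp: square_integrable_def\<close>)
    then show ?thesis using S by (simp add: L2_norm_square square_integrable_def)
  qed
  moreover have "2 * \<epsilon> * (LINT x|lborel. w x * uxx x) \<le> 2 * \<epsilon> * K * L2_norm w"
  proof -
    have "(LINT x|lborel. w x * uxx x) \<le> L2_norm w * L2_norm uxx"
      using L2_Cauchy_Schwarz[OF S(3) sq(3)] by linarith
    also have "\<dots> \<le> K * L2_norm w"
      using mult_left_mono[OF bounds(6) L2_norm_nonneg[of w]] by (simp add: mult.commute)
    finally show ?thesis using \<epsilon> by (simp add: mult.assoc mult_left_mono)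
  qed
  ultimately show ?thesis by linarith
qed

text \<open>The number \<open>m\<close> compensates for the weight \<open>\<delta>\<close> in the
  energy: the sum of the three squares is at most E / m. Thus 4 K becomes 2 A with A = 2 K / m, the
  forcing gives B = \<epsilon> K, and returning from \<open>E\<close> to the three norms costs 1 /
  sqrt m.\<close>

lemma ivp_difference_bound:
  assumes \<delta>: "\<delta> > 0" and T: "T > 0" and \<epsilon>: "\<epsilon> > 0"
    and sol: "ivp_solution \<delta> \<epsilon> T 1 f g \<eta>\<epsilon> u\<epsilon>" and sol0: "ivp_solution \<delta> 0 T 2 f g \<eta>0 u0"
    and K: "\<And>t. t \<in> {0..T} \<Longrightarrow> sobolev_norm 1 (\<eta>\<epsilon> t) + sobolev_norm 2 (u\<epsilon> t) \<le> K"
      "\<And>t. t \<in> {0..T} \<Longrightarrow> sobolev_norm 2 (\<eta>0 t) + sobolev_norm 2 (u0 t) \<le> K"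
    and t: "t \<in> {0..T}"
  defines "h \<equiv> \<lambda>t x. \<eta>\<epsilon> t x - \<eta>0 t x" and "w \<equiv> \<lambda>t x. u\<epsilon> t x - u0 t x" and "m \<equiv> min 1 \<delta>"
  shows "sqrt ((L2_norm (h t))\<^sup>2 + (L2_norm (w t))\<^sup>2 + (L2_norm (weak_deriv 1 (w t)))\<^sup>2)
    \<le> K * exp (2 * K / m * T) / sqrt m * \<epsilon> * t"
proof -
  have m: "m > 0" "m \<le> 1" "m \<le> \<delta>" using \<delta> by (auto simp: m_def)
  obtain \<eta>\<epsilon>t u\<epsilon>t where
      C1\<epsilon>: "C1_sobolev 1 T \<eta>\<epsilon> \<eta>\<epsilon>t" "C1_sobolev 2 T u\<epsilon> u\<epsilon>t"
    and eq\<epsilon>: "\<And>t. t \<in> {0..T} \<Longrightarrow> AE x in lborel.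
        \<eta>\<epsilon>t t x + weak_deriv 1 (u\<epsilon> t) x + weak_deriv 1 (\<lambda>y. \<eta>\<epsilon> t y * u\<epsilon> t y) x = 0"
      "\<And>t. t \<in> {0..T} \<Longrightarrow> AE x in lborel.
        u\<epsilon>t t x + weak_deriv 1 (\<eta>\<epsilon> t) x + u\<epsilon> t x * weak_deriv 1 (u\<epsilon> t) x
          - \<delta> * weak_deriv 2 (u\<epsilon>t t) x - \<epsilon> * weak_deriv 2 (u\<epsilon> t) x = 0"
    and init\<epsilon>: "AE x in lborel. \<eta>\<epsilon> 0 x = f x" "AE x in lborel. u\<epsilon> 0 x = g x"
    using sol unfolding ivp_solution_def by blast
  obtain \<eta>0t u0t where
      C10: "C1_sobolev 2 T \<eta>0 \<eta>0t" "C1_sobolev 2 T u0 u0t"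
    and eq0: "\<And>t. t \<in> {0..T} \<Longrightarrow> AE x in lborel.
        \<eta>0t t x + weak_deriv 1 (u0 t) x + weak_deriv 1 (\<lambda>y. \<eta>0 t y * u0 t y) x = 0"
      "\<And>t. t \<in> {0..T} \<Longrightarrow> AE x in lborel.
        u0t t x + weak_deriv 1 (\<eta>0 t) x + u0 t x * weak_deriv 1 (u0 t) x
          - \<delta> * weak_deriv 2 (u0t t) x - 0 * weak_deriv 2 (u0 t) x = 0"
    and init0: "AE x in lborel. \<eta>0 0 x = f x" "AE x in lborel. u0 0 x = g x"
    using sol0 unfolding ivp_solution_def by blast
  have S: "sobolev 1 (\<eta>\<epsilon> s)" "sobolev 2 (u\<epsilon> s)" "sobolev 2 (\<eta>0 s)" "sobolev 2 (u0 s)"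
    "sobolev 1 (\<eta>\<epsilon>t s)" "sobolev 2 (u\<epsilon>t s)" "sobolev 2 (\<eta>0t s)" "sobolev 2 (u0t s)"
    if "s \<in> {0..T}" for s
    using C1\<epsilon> C10 that by (auto simp: C1_sobolev_def)
  \<comment> \<open>A difference of chosen derivatives, not the choice for the difference: time
    differentiability is available for each solution separately. The two agree a.e., which is used
    only at the end.\<close>
  define wx where "wx s x = weak_deriv 1 (u\<epsilon> s) x - weak_deriv 1 (u0 s) x" for s x
  define ht where "ht s x = \<eta>\<epsilon>t s x - \<eta>0t s x" for s x
  define wt where "wt s x = u\<epsilon>t s x - u0t s x" for s x
  define wtx where "wtx s x = weak_deriv 1 (u\<epsilon>t s) x - weak_deriv 1 (u0t s) x" for s x
  define wtxx where "wtxx s x = weak_deriv 2 (u\<epsilon>t s) x - weak_deriv 2 (u0t s) x" for s x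
  have h: "H1 (h s) (\<lambda>x. weak_deriv 1 (\<eta>\<epsilon> s) x - weak_deriv 1 (\<eta>0 s) x)" if "s \<in> {0..T}" for s
    unfolding h_def by (intro H1_diff sobolev_H1[OF S(1)[OF that]] sobolev_H1[OF S(3)[OF that]]) auto
  have w: "H1 (w s) (wx s)" if "s \<in> {0..T}" for s
    unfolding w_def wx_def
    by (intro H1_diff sobolev_H1[OF S(2)[OF that]] sobolev_H1[OF S(4)[OF that]]) auto
  have wt_H1: "H1 (wtx s) (wtxx s)" if "s \<in> {0..T}" for s
    unfolding wtx_def wtxx_def
    by (intro H1_diff sobolev_H1'[OF S(6)[OF that]] sobolev_H1'[OF S(8)[OF that]]) auto
  define E where "E s = (L2_norm (h s))\<^sup>2 + (L2_norm (w s))\<^sup>2 + \<delta> * (L2_norm (wx s))\<^sup>2" for s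
  define E' where "E' s = 2 * (LINT x|lborel. h s x * ht s x) + 2 * (LINT x|lborel. w s x * wt s x)
      + \<delta> * (2 * (LINT x|lborel. wx s x * wtx s x))" for s
  have E0: "0 \<le> E s" for s using \<delta> by (simp add: E_def)
  have mE: "m * ((L2_norm (h s))\<^sup>2 + (L2_norm (w s))\<^sup>2 + (L2_norm (wx s))\<^sup>2) \<le> E s" for s
    using mult_right_mono[OF m(2), of "(L2_norm (h s))\<^sup>2"] mult_right_mono[OF m(2), of "(L2_norm (w s))\<^sup>2"]
      mult_right_mono[OF m(3), of "(L2_norm (wx s))\<^sup>2"]
    by (simp add: E_def distrib_left)
  have "0 \<le> K" using K(1)[OF t] sobolev_norm_nonneg[of 1 "\<eta>\<epsilon> t"] sobolev_norm_nonneg[of 2 "u\<epsilon> t"] by linarith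
  have deriv: "(E has_real_derivative E' s) (at s within {0..T})" if s: "s \<in> {0..T}" for s
  proof -
    have "has_L2_deriv h (ht s) s {0..T}"
      unfolding h_def ht_def
      by (rule has_L2_deriv_diff[OF C1_sobolev_has_L2_deriv_0[OF C1\<epsilon>(1) s] C1_sobolev_has_L2_deriv_0[OF C10(1) s]])
    moreover have "has_L2_deriv w (wt s) s {0..T}"
      unfolding w_def wt_def
      by (rule has_L2_deriv_diff[OF C1_sobolev_has_L2_deriv_0[OF C1\<epsilon>(2) s] C1_sobolev_has_L2_deriv_0[OF C10(2) s]])
    moreover have "has_L2_deriv wx (wtx s) s {0..T}"
      unfolding wx_def wtx_def
      by (intro has_L2_deriv_diff C1_sobolev_has_L2_deriv[OF C1\<epsilon>(2) _ s] C1_sobolev_has_L2_deriv[OF C10(2) _ s]) auto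
    ultimately show ?thesis
      unfolding E_def E'_def by (intro DERIV_add DERIV_cmult has_L2_deriv_norm_square)
  qed
  have est: "E' s \<le> 2 * (2 * K / m) * E s + 2 * (\<epsilon> * K) * sqrt (E s)" if s: "s \<in> {0..T}" for s
  proof -
    have K': "sobolev_norm 2 (u\<epsilon> s) \<le> K" "sobolev_norm 2 (\<eta>0 s) \<le> K" "sobolev_norm 2 (u0 s) \<le> K"
      using K[OF s] sobolev_norm_nonneg[of 1 "\<eta>\<epsilon> s"] sobolev_norm_nonneg[of 2 "u\<epsilon> s"]
        sobolev_norm_nonneg[of 2 "\<eta>0 s"] sobolev_norm_nonneg[of 2 "u0 s"] by linarith+
    have le: "AE x in lborel. \<bar>k x\<bar> \<le> K" if "AE x in lborel. \<bar>k x\<bar> \<le> B" "B \<le> K" for k :: "real \<Rightarrow> real" and B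
      using that by (auto elim!: eventually_mono)
    \<comment> \<open>The equations contain the choice for the derivative of a product; Leibniz's
      formula has to hold for it before the nonlinear terms can be split by algebra.\<close>
    have p\<epsilon>: "AE x in lborel. weak_deriv 1 (\<lambda>y. \<eta>\<epsilon> s y * u\<epsilon> s y) x =
        weak_deriv 1 (\<eta>\<epsilon> s) x * u\<epsilon> s x + \<eta>\<epsilon> s x * weak_deriv 1 (u\<epsilon> s) x"
      using H1_mult[OF sobolev_H1[OF S(1)[OF s]] sobolev_H1[OF S(2)[OF s]]]
      by (intro weak_deriv_AE_eq) (simp add: H1_def)
    have p0: "AE x in lborel. weak_deriv 1 (\<lambda>y. \<eta>0 s y * u0 s y) x =
        weak_deriv 1 (\<eta>0 s) x * u0 s x + \<eta>0 s x * weak_deriv 1 (u0 s) x"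
      using H1_mult[OF sobolev_H1[OF S(3)[OF s]] sobolev_H1[OF S(4)[OF s]]]
      by (intro weak_deriv_AE_eq) (simp add: H1_def)
    have "E' s \<le> 4 * K * ((L2_norm (h s))\<^sup>2 + (L2_norm (w s))\<^sup>2 + (L2_norm (wx s))\<^sup>2) + 2 * \<epsilon> * K * L2_norm (w s)"
      unfolding E'_def
    proof (rule energy_estimate[OF h[OF s] w[OF s] wt_H1[OF s] sobolev_H1[OF S(2)[OF s]]
          sobolev_H1[OF S(3)[OF s]] sobolev_H1[OF S(4)[OF s]]])
      show "square_integrable (ht s)" "square_integrable (wt s)" "square_integrable (weak_deriv 2 (u\<epsilon> s))"
        unfolding ht_def wt_def
        using S[OF s, THEN sobolev_square_integrable] sobolev_weak_deriv(2)[OF S(2)[OF s], of 2]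
        by (auto intro: square_integrable_diff)
      show "AE x in lborel. \<bar>\<eta>0 s x\<bar> \<le> K" "AE x in lborel. \<bar>weak_deriv 1 (\<eta>0 s) x\<bar> \<le> K"
        "AE x in lborel. \<bar>u\<epsilon> s x\<bar> \<le> K" "AE x in lborel. \<bar>weak_deriv 1 (u\<epsilon> s) x\<bar> \<le> K"
        "AE x in lborel. \<bar>weak_deriv 1 (u0 s) x\<bar> \<le> K"
        by (rule le[OF sobolev_sup_bound[OF S(3)[OF s]] K'(2)] le[OF sobolev_deriv_sup_bound[OF S(3)[OF s]] K'(2)]
          le[OF sobolev_sup_bound[OF S(2)[OF s]] K'(1)] le[OF sobolev_deriv_sup_bound[OF S(2)[OF s]] K'(1)]
          le[OF sobolev_deriv_sup_bound[OF S(4)[OF s]] K'(3)]; simp)+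
      show "L2_norm (weak_deriv 2 (u\<epsilon> s)) \<le> K"
        using L2_norm_weak_deriv_le[of 2 2 "u\<epsilon> s"] K'(1) by simp
      show "AE x in lborel. ht s x = - (wx s x +
          (weak_deriv 1 (\<eta>0 s) x * w s x + \<eta>0 s x * wx s x) +
          ((weak_deriv 1 (\<eta>\<epsilon> s) x - weak_deriv 1 (\<eta>0 s) x) * u\<epsilon> s x + h s x * weak_deriv 1 (u\<epsilon> s) x))"
        using eq\<epsilon>(1)[OF s] eq0(1)[OF s] p\<epsilon> p0
      proof eventually_elim
        case (elim x)
        then show ?case unfolding ht_def wx_def w_def h_def by algebra
      qed
      show "AE x in lborel. wt s x - \<delta> * wtxx s x =
          - ((weak_deriv 1 (\<eta>\<epsilon> s) x - weak_deriv 1 (\<eta>0 s) x) + u\<epsilon> s x * wx s x + w s x * weak_deriv 1 (u0 s) x)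
          + \<epsilon> * weak_deriv 2 (u\<epsilon> s) x"
        using eq\<epsilon>(2)[OF s] eq0(2)[OF s]
      proof eventually_elim
        case (elim x)
        then show ?case unfolding wt_def wtxx_def wx_def w_def by algebra
      qed
    qed (use \<epsilon> in auto)
    \<comment> \<open>Everything is now expressed through \<open>E\<close>: the quadratic part costs
      1 / m, while \<open>w\<close> has weight 1 in \<open>E\<close>, so its norm is at most sqrt
      E.\<close>
    also have "\<dots> \<le> 4 * K * (E s / m) + 2 * \<epsilon> * K * sqrt (E s)"
    proof (intro add_mono mult_left_mono)
      show "(L2_norm (h s))\<^sup>2 + (L2_norm (w s))\<^sup>2 + (L2_norm (wx s))\<^sup>2 \<le> E s / m"
        using mE[of s] m(1) by (simp add: pos_le_divide_eq mult.commute)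
      show "L2_norm (w s) \<le> sqrt (E s)"
        using \<delta> by (intro real_le_rsqrt) (simp add: E_def)
    qed (use \<open>0 \<le> K\<close> \<epsilon> in auto)
    finally show ?thesis by (simp add: mult.assoc)
  qed
  have zero: "E 0 = 0"
  proof -
    have 0: "0 \<in> {0..T}" using T by simp
    have *: "L2_norm k = 0" if "AE x in lborel. k x = 0" for k
    proof -
      have "(LINT x|lborel. (k x)\<^sup>2) = 0"
        by (rule integral_eq_zero_AE) (use that in \<open>auto elim: eventually_mono\<close>)
      then show ?thesis by (simp add: L2_norm_def)
    qed
    have "AE x in lborel. h 0 x = 0" "AE x in lborel. w 0 x = 0"
      unfolding h_def w_def using init\<epsilon> init0 by (auto elim: eventually_elim2)
    \<comment> \<open>The initial difference vanishes only a.e., so \<open>wx 0\<close> is first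
      recognised as a weak derivative of the zero function; uniqueness then applies.\<close>
    moreover have "AE x in lborel. wx 0 x = 0"
    proof -
      have wd: "has_weak_deriv 1 (w 0) (wx 0)" using w[OF 0] by (simp add: H1_def)
      then have "wx 0 \<in> borel_measurable lborel"
        by (auto simp: has_weak_deriv_def intro!: locally_integrable_measurable[simplified])
      then have "has_weak_deriv 1 (\<lambda>x. 0) (wx 0)"
        by (intro has_weak_deriv_cong_AE[OF wd \<open>AE x in lborel. w 0 x = 0\<close>]) auto
      moreover have "has_weak_deriv 1 (\<lambda>x. 0) (\<lambda>x. 0)"
        using has_weak_deriv_diff[OF wd wd] by simp
      ultimately show ?thesis by (rule has_weak_deriv_unique)
    qed
    ultimately show ?thesis by (simp add: E_def *)
  qed
  have G: "sqrt (E t) \<le> (\<epsilon> * K) * t * exp (2 * K / m * t)"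
    using \<open>0 \<le> K\<close> m \<epsilon> by (intro Gronwall_sqrt[OF deriv est E0 zero _ _ t]) auto
  have "L2_norm (weak_deriv 1 (w t)) = L2_norm (wx t)"
  proof (rule L2_norm_cong_AE)
    have wd: "has_weak_deriv 1 (w t) (wx t)" using w[OF t] by (simp add: H1_def)
    show "AE x in lborel. weak_deriv 1 (w t) x = wx t x" by (rule weak_deriv_AE_eq[OF wd])
    show "wx t \<in> borel_measurable borel" "weak_deriv 1 (w t) \<in> borel_measurable borel"
      using wd has_weak_deriv_weak_deriv[OF wd]
      by (auto simp: has_weak_deriv_def intro!: locally_integrable_measurable[simplified])
  qed
  then have "sqrt ((L2_norm (h t))\<^sup>2 + (L2_norm (w t))\<^sup>2 + (L2_norm (weak_deriv 1 (w t)))\<^sup>2) \<le> sqrt (E t / m)"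
    using mE[of t] m(1) by (intro real_sqrt_le_mono) (simp add: pos_le_divide_eq mult.commute)
  also have "\<dots> \<le> (\<epsilon> * K) * t * exp (2 * K / m * t) / sqrt m"
    using G m by (simp add: real_sqrt_divide divide_right_mono)
  \<comment> \<open>Only the exponent is enlarged to \<open>T\<close>, which frees the constant from
    the time; the linear factor \<open>t\<close> is kept.\<close>
  also have "\<dots> \<le> (\<epsilon> * K) * t * exp (2 * K / m * T) / sqrt m"
    using t m \<epsilon> \<open>0 \<le> K\<close> by (intro divide_right_mono mult_left_mono) (auto intro!: mult_left_mono divide_right_mono)
  finally show ?thesis by (simp add: mult_ac)
qed

theorem theorem4p1:
  fixes \<delta> T K :: real
  assumes "\<delta> > 0" and "T > 0"
  shows "\<exists>C>0. \<forall>f g :: real \<Rightarrow> real. \<forall>\<epsilon>>0. \<forall>\<eta>\<epsilon> u\<epsilon> \<eta>0 u0 :: real \<Rightarrow> real \<Rightarrow> real.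
    sobolev 2 f \<longrightarrow> sobolev 2 g \<longrightarrow>
    unique_ivp_solution \<delta> \<epsilon> T 1 f g \<eta>\<epsilon> u\<epsilon> \<longrightarrow>
    unique_ivp_solution \<delta> 0 T 2 f g \<eta>0 u0 \<longrightarrow>
    (\<forall>t\<in>{0..T}. sobolev_norm 1 (\<eta>\<epsilon> t) + sobolev_norm 2 (u\<epsilon> t) \<le> K) \<longrightarrow>
    (\<forall>t\<in>{0..T}. sobolev_norm 2 (\<eta>0 t) + sobolev_norm 2 (u0 t) \<le> K) \<longrightarrow>
    (let h = (\<lambda>t x. \<eta>\<epsilon> t x - \<eta>0 t x);
         w = (\<lambda>t x. u\<epsilon> t x - u0 t x)
     in \<forall>t\<in>{0..T}.
          sqrt ((L2_norm (h t))\<^sup>2 + (L2_norm (w t))\<^sup>2 + (L2_norm (weak_deriv 1 (w t)))\<^sup>2)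
            \<le> C * \<epsilon> * t)"
proof -
  \<comment> \<open>The bound also holds for any larger \<open>K\<close>; \<open>\<bar>K\<bar> + 1\<close> makes the constant positive.\<close>
  let ?C = "(\<bar>K\<bar> + 1) * exp (2 * (\<bar>K\<bar> + 1) / min 1 \<delta> * T) / sqrt (min 1 \<delta>)"
  have "?C > 0" using assms by (auto intro!: divide_pos_pos mult_pos_pos)
  moreover have "sqrt ((L2_norm (\<lambda>x. \<eta>\<epsilon> t x - \<eta>0 t x))\<^sup>2 + (L2_norm (\<lambda>x. u\<epsilon> t x - u0 t x))\<^sup>2
      + (L2_norm (weak_deriv 1 (\<lambda>x. u\<epsilon> t x - u0 t x)))\<^sup>2) \<le> ?C * \<epsilon> * t"
    if "\<epsilon> > 0" "unique_ivp_solution \<delta> \<epsilon> T 1 f g \<eta>\<epsilon> u\<epsilon>" "unique_ivp_solution \<delta> 0 T 2 f g \<eta>0 u0"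
      "\<forall>t\<in>{0..T}. sobolev_norm 1 (\<eta>\<epsilon> t) + sobolev_norm 2 (u\<epsilon> t) \<le> K"
      "\<forall>t\<in>{0..T}. sobolev_norm 2 (\<eta>0 t) + sobolev_norm 2 (u0 t) \<le> K" "t \<in> {0..T}"
    for f g \<epsilon> \<eta>\<epsilon> u\<epsilon> \<eta>0 u0 t
    using that assms
    by (intro ivp_difference_bound[where f = f and g = g])
      (fastforce simp: unique_ivp_solution_def)+
  ultimately show ?thesis
    unfolding Let_def by blast
qed

end
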